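(* Let $\mathcal{M} = (\mathcal{S}, \mathcal{A}, \Psi, \mathcal{R}, p)$ and $\mathcal{M}' = (\mathcal{S}', \mathcal{A}', \Psi', \mathcal{R}', p')$ be MDPs, and let $(\mathcal{M}', \sim)$ with $\sim = (\sim_{\mathcal{S}'}, \sim_{\Psi'})$ be a hidden symmetry of $\mathcal{M}$. Let $h = (f, \{g_s \mid s \in \mathcal{S}\})$ be a relabeling from $\Psi$ to $\Psi'$ with respect to the equivalence of the MDPs $\mathcal{M}$ and $\mathcal{M}'$. For a policy $\pi \in \Pi(\mathcal{M}'/\!\sim)$ define its pullback $\pi' \in \Pi(\mathcal{M})$ by $$\pi'(s,a) = \frac{\pi\big([(f(s), g_s(a))]_{\Psi'}\big)}{N_{\Psi'}(f(s), g_s(a))} \qquad \text{for all } (s,a) \in \Psi.$$ If $\pi$ is optimal in $\mathcal{M}'/\!\sim$, then $\pi'$ is optimal in $\mathcal{M}$. In particular, every optimal policy in the quotient MDP $\mathcal{M}'/\!\sim$ can be pulled back to an optimal policy in $\mathcal{M}$. Moreover, if $\sim$ is simple, the pullback simplifies to $\pi'(s,a) = \pi(g_s(a) \mid [f(s)])$.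
   Context: **MDPs.** A Markov decision process (MDP) is a tuple $\mathcal{M} = (\mathcal{S}, \mathcal{A}, \Psi, \mathcal{R}, p)$ where $\mathcal{S}$ is a countable set of states, $\mathcal{A}$ is a set of actions, $\Psi \subseteq \mathcal{S}\times\mathcal{A}$ is the set of admissible state-action pairs such that $\mathcal{A}(s) = \{a \in \mathcal{A} \mid (s,a)\in\Psi\}$ is nonempty and finite for every $s$, $\mathcal{R}\subseteq\mathbb{R}$ is a bounded set of rewards, and $p\colon \mathcal{S}\times\mathcal{R}\times\Psi\to[0,1]$ (the dynamic), written $p(s',r\mid s,a) = p(s',r,(s,a))$, satisfies $\sum_{s'\in\mathcal{S}, r\in\mathcal{R}} p(s',r\mid s,a) = 1$ for all $(s,a)\in\Psi$. The value $p(s',r\mid s,a)$ is the probability of moving to $s'$ and receiving reward $r$ when taking action $a$ in state $s$. Put $p(s'\mid s,a) = \sum_{r\in\mathcal{R}} p(s',r\mid s,a)$. **Policies and optimality.** A policy is a map $\pi\colon\Psi\to[0,1]$, written $\pi(a\mid s) = \pi(s,a) = \pi((s,a))$, with $\sum_{a\in\mathcal{A}(s)}\pi(a\mid s) = 1$ for all $s\in\mathcal{S}$. $\Pi(\mathcal{M})$ is the set of all policies. A policy and a starting state $S_0$ induce a random trajectory $(S_0,A_0,R_1,S_1,A_1,R_2,\dots)$. With a fixed discount factor $\gamma\in[0,1)$ (the same for all MDPs considered, with $0^0=1$), the value function is $V_\pi^{\mathcal{M}}(s) = \mathbb{E}_{\pi,p}[\sum_{k=0}^\infty \gamma^k R_{k+1}\mid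 S_0 = s]$, and $V_*^{\mathcal{M}}(s) = \sup_{\pi\in\Pi(\mathcal{M})}V_\pi^{\mathcal{M}}(s)$. A policy $\pi$ is optimal if $V_\pi^{\mathcal{M}}(s) = V_*^{\mathcal{M}}(s)$ for all $s$; $\Pi_*(\mathcal{M})$ is the set of optimal policies. **Visible symmetry.** A visible symmetry of $\mathcal{M}$ is a pair $\sim = (\sim_{\mathcal{S}},\sim_\Psi)$ of equivalence relations on $\mathcal{S}$ and on $\Psi$ such that (i) for all $(s_1,a_1)\in\Psi$ and $s_2\in\mathcal{S}$ with $s_1\sim_{\mathcal{S}}s_2$ there is $a_2\in\mathcal{A}(s_2)$ with $(s_1,a_1)\sim_\Psi(s_2,a_2)$; and (ii) whenever $(s_1,a_1)\sim_\Psi(s_2,a_2)$, then $s_1\sim_{\mathcal{S}}s_2$ and $p(X,r\mid s_1,a_1) = p(X,r\mid s_2,a_2)$ for all classes $X\in\mathcal{S}/\!\sim_{\mathcal{S}}$ and all $r\in\mathcal{R}$, where $p(X,r\mid s,a) = \sum_{\tilde s\in X}p(\tilde s,r\mid s,a)$. It is simple if $(s_1,a_1)\sim_\Psi(s_2,a_2)$ implies $a_1=a_2$. Put $N_\Psi(s,a) = |\{a'\in\mathcal{A}(s)\mid (s,a)\sim_\Psi(s,a')\}|$. **Quotient MDP.** $\mathcal{M}/\!\sim$ is the MDP with states $\mathcal{S}/\!\sim_{\mathcal{S}}$, admissible state-action pairs $\Psi/\!\sim_\Psi$ (the class $[(s,a)]_\Psi$ is regarded as an action admissible in the state $[s]$;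 choosing representatives identifies $\Psi/\!\sim_\Psi$ with a subset of $(\mathcal{S}/\!\sim_{\mathcal{S}})\times\mathcal{A}$), rewards $\mathcal{R}$, and dynamic $\overline{p}([s'],r\mid[(s,a)]) = \sum_{\tilde s\in[s']}p(\tilde s,r\mid s,a)$. So a policy in $\mathcal{M}/\!\sim$ is a map $\pi\colon\Psi/\!\sim_\Psi\to[0,1]$ whose values sum to $1$ over the pair classes belonging to each state class. If $\sim$ is simple, one writes $\pi(a\mid[s])$ for $\pi([(s,a)])$. **Relabeling.** A relabeling of $\mathcal{M} = (\mathcal{S},\mathcal{A},\Psi,\mathcal{R},p)$ to $\mathcal{M}' = (\mathcal{S}',\mathcal{A}',\Psi',\mathcal{R},p')$ (same reward set) is a tuple $h = (f,\{g_s\mid s\in\mathcal{S}\})$ of bijections $f\colon\mathcal{S}\to\mathcal{S}'$ and $g_s\colon\mathcal{A}(s)\to\mathcal{A}'(f(s))$ with $p(\tilde s,r\mid s,a) = p'(f(\tilde s),r\mid f(s),g_s(a))$ for all $(s,a)\in\Psi$, $\tilde s\in\mathcal{S}$, $r\in\mathcal{R}$. Then $\mathcal{M}'$ is called a relabeled variant of $\mathcal{M}$. **Same transition structure.** Two MDPs $(\mathcal{S},\mathcal{A},\Psi,\mathcal{R},p)$ and $(\mathcal{S},\mathcal{A},\Psi,\mathcal{R}',p')$ have the same transition structure if $p(s'\mid s,a) = p'(s'\mid s,a)$ for all $(s,a)\in\Psi$, $s'\in\mathcal{S}$. **Equivalence.** MDPs $\mathcal{M}$ and $\mathcal{M}'$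 are equivalent if one of the following holds: (1) $\mathcal{M}'$ is a relabeled variant of $\mathcal{M}$; (2) $\mathcal{M}$ and $\mathcal{M}'$ have the same transition structure and the same optimal policies; (3) there is an MDP $\tilde{\mathcal{M}}$ that is a relabeled variant of $\mathcal{M}$ such that $\tilde{\mathcal{M}}$ and $\mathcal{M}'$ have the same transition structure and the same optimal policies; (4) there is an MDP $\tilde{\mathcal{M}}$ such that $\mathcal{M}$ and $\tilde{\mathcal{M}}$ have the same transition structure and the same optimal policies and $\mathcal{M}'$ is a relabeled variant of $\tilde{\mathcal{M}}$. A relabeling $h$ of $\Psi$ to $\Psi'$ with respect to this equivalence is: in cases (1), (3), (4) the relabeling of MDPs occurring there ($\mathcal{M}$ to $\mathcal{M}'$, $\mathcal{M}$ to $\tilde{\mathcal{M}}$, $\tilde{\mathcal{M}}$ to $\mathcal{M}'$, respectively); in case (2) the trivial one ($f$ and all $g_s$ identities). **Hidden symmetry.** $(\mathcal{M}',\sim)$ is a hidden symmetry of $\mathcal{M}$ if $\mathcal{M}$ and $\mathcal{M}'$ are equivalent and $\sim$ is a visible symmetry of $\mathcal{M}'$. *)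

theory Defs
  imports "HOL-Probability.Probability"
begin

record ('s, 'a) mdp =
  states :: "'s set"
  actions :: "'a set"
  pairs :: "('s \<times> 'a) set"
  rewards :: "real set"
  dyn :: "'s \<Rightarrow> real \<Rightarrow> 's \<times> 'a \<Rightarrow> real"

definition adm :: "('s, 'a) mdp \<Rightarrow> 's \<Rightarrow> 'a set" where
  "adm M s = {a \<in> actions M. (s, a) \<in> pairs M}"

(* The reward set may be uncountable, hence an unordered sum. *)
definition is_mdp :: "('s, 'a) mdp \<Rightarrow> bool" where
  "is_mdp M \<longleftrightarrow>
     countable (states M) \<and>
     pairs M \<subseteq> states M \<times> actions M \<and>
     (\<forall>s\<in>states M. adm M s \<noteq> {} \<and> finite (adm M s)) \<and>
     bounded (rewards M) \<and>
     (\<forall>x\<in>pairs M. \<forall>s'\<in>states M. \<forall>r\<in>rewards M. dyn M s' r x \<in> {0..1}) \<and>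
     (\<forall>x\<in>pairs M. ((\<lambda>(s', r). dyn M s' r x) has_sum 1) (states M \<times> rewards M))"

(* p(s' | s, a) *)
definition trans_prob :: "('s, 'a) mdp \<Rightarrow> 's \<Rightarrow> 's \<times> 'a \<Rightarrow> real" where
  "trans_prob M s' x = (\<Sum>\<^sub>\<infinity>r\<in>rewards M. dyn M s' r x)"

(* p(X, r | s, a) for a set X of states *)
definition set_prob :: "('s, 'a) mdp \<Rightarrow> 's set \<Rightarrow> real \<Rightarrow> 's \<times> 'a \<Rightarrow> real" where
  "set_prob M X r x = (\<Sum>\<^sub>\<infinity>s'\<in>X. dyn M s' r x)"

(* Policies are functions on the admissible pairs; PiE makes them extensional, so that
   comparing sets of policies only compares values on admissible pairs. *)
definition policies :: "('s, 'a) mdp \<Rightarrow> ('s \<times> 'a \<Rightarrow> real) set" where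
  "policies M = {\<pi> \<in> pairs M \<rightarrow>\<^sub>E {0..1}. \<forall>s\<in>states M. (\<Sum>a\<in>adm M s. \<pi> (s, a)) = 1}"

definition action_pmf :: "('s, 'a) mdp \<Rightarrow> ('s \<times> 'a \<Rightarrow> real) \<Rightarrow> 's \<Rightarrow> 'a pmf" where
  "action_pmf M \<pi> s = embed_pmf (\<lambda>a. if a \<in> adm M s then \<pi> (s, a) else 0)"

definition outcome_pmf :: "('s, 'a) mdp \<Rightarrow> 's \<times> 'a \<Rightarrow> ('s \<times> real) pmf" where
  "outcome_pmf M x =
     embed_pmf (\<lambda>(s', r). if s' \<in> states M \<and> r \<in> rewards M then dyn M s' r x else 0)"

(* Distribution of (A, R, S') when acting once from state s. *)
definition step_pmf ::
  "('s, 'a) mdp \<Rightarrow> ('s \<times> 'a \<Rightarrow> real) \<Rightarrow> 's \<Rightarrow> ('a \<times> real \<times> 's) pmf" where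
  "step_pmf M \<pi> s =
     bind_pmf (action_pmf M \<pi> s)
       (\<lambda>a. map_pmf (\<lambda>(s', r). (a, r, s')) (outcome_pmf M (s, a)))"

(* A trajectory S_0, A_0, R_1, S_1, A_1, R_2, ... with S_0 = s is encoded by the sequence
   n \<mapsto> (A_n, R_{n+1}, S_{n+1}); its law is the Ionescu-Tulcea product of the kernels below.
   All coordinates carry the discrete sigma-algebra. *)
primrec state_at :: "'s \<Rightarrow> (nat \<Rightarrow> 'a \<times> real \<times> 's) \<Rightarrow> nat \<Rightarrow> 's" where
  "state_at s \<omega> 0 = s"
| "state_at s \<omega> (Suc n) = snd (snd (\<omega> n))"

definition kernel ::
  "('s, 'a) mdp \<Rightarrow> ('s \<times> 'a \<Rightarrow> real) \<Rightarrow> 's \<Rightarrow> nat \<Rightarrow> (nat \<Rightarrow> 'a \<times> real \<times> 's)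
     \<Rightarrow> ('a \<times> real \<times> 's) measure" where
  "kernel M \<pi> s n \<omega> = measure_pmf (step_pmf M \<pi> (state_at s \<omega> n))"

definition trajectory ::
  "('s, 'a) mdp \<Rightarrow> ('s \<times> 'a \<Rightarrow> real) \<Rightarrow> 's \<Rightarrow> (nat \<Rightarrow> 'a \<times> real \<times> 's) measure" where
  "trajectory M \<pi> s =
     projective_family.lim UNIV
       (Ionescu_Tulcea.CI (kernel M \<pi> s) (\<lambda>_. count_space UNIV)) (\<lambda>_. count_space UNIV)"

lemma Ionescu_Tulcea_kernel: "Ionescu_Tulcea (kernel M \<pi> s) (\<lambda>_. count_space UNIV)"
proof (rule Ionescu_Tulcea.intro)
  fix n
  have step: "(\<lambda>t. measure_pmf (step_pmf M \<pi> t)) \<in>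
      measurable (count_space UNIV) (subprob_algebra (count_space UNIV))"
    by (auto simp: space_subprob_algebra
          intro: prob_space_imp_subprob_space prob_space_measure_pmf)
  have "(\<lambda>\<omega>. state_at s \<omega> n) \<in>
      measurable (PiM {0..<n} (\<lambda>_. count_space UNIV)) (count_space UNIV)"
  proof (cases n)
    case (Suc m)
    have "(\<lambda>\<omega>. \<omega> m) \<in> measurable (PiM {0..<Suc m} (\<lambda>_. count_space UNIV)) (count_space UNIV)"
      by (rule measurable_component_singleton) simp
    from measurable_compose[OF this, of "\<lambda>x. snd (snd x)" "count_space UNIV"]
    show ?thesis using Suc by simp
  qed simp
  from measurable_compose[OF this step]
  show "kernel M \<pi> s n \<in>
      measurable (PiM {0..<n} (\<lambda>_. count_space UNIV)) (subprob_algebra (count_space UNIV))"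
    by (simp add: kernel_def[abs_def])
qed (simp add: kernel_def prob_space_measure_pmf)

lemma pmf_action_pmf:
  assumes "is_mdp M" "\<pi> \<in> policies M" "s \<in> states M"
  shows "pmf (action_pmf M \<pi> s) a = (if a \<in> adm M s then \<pi> (s, a) else 0)"
proof -
  have fin: "finite (adm M s)" and sum: "(\<Sum>a\<in>adm M s. \<pi> (s, a)) = 1"
    using assms by (auto simp: is_mdp_def policies_def)
  have nn: "0 \<le> \<pi> (s, a)" if "a \<in> adm M s" for a
    using assms that by (auto simp: adm_def policies_def dest!: PiE_mem)
  have "(\<integral>\<^sup>+ a. ennreal (if a \<in> adm M s then \<pi> (s, a) else 0) \<partial>count_space UNIV) =
      (\<Sum>a\<in>adm M s. ennreal (\<pi> (s, a)))"
    by (subst nn_integral_count_space'[of "adm M s"]) (auto simp: fin)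
  also have "\<dots> = 1" using nn sum by (simp add: sum_ennreal)
  finally have "pmf (embed_pmf (\<lambda>a. if a \<in> adm M s then \<pi> (s, a) else 0)) a =
      (if a \<in> adm M s then \<pi> (s, a) else 0)"
    by (intro pmf_embed_pmf) (simp_all add: nn)
  then show ?thesis by (simp only: action_pmf_def)
qed

lemma pmf_outcome_pmf:
  assumes "is_mdp M" "x \<in> pairs M"
  shows "pmf (outcome_pmf M x) (s', r) =
    (if s' \<in> states M \<and> r \<in> rewards M then dyn M s' r x else 0)"
proof -
  let ?A = "states M \<times> rewards M" and ?f = "\<lambda>(s', r). dyn M s' r x"
  have nn: "0 \<le> dyn M s' r x" if "s' \<in> states M" "r \<in> rewards M" for s' r
    using assms that by (auto simp: is_mdp_def)
  have hs: "(?f has_sum 1) ?A" using assms by (auto simp: is_mdp_def)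
  have abs: "Infinite_Set_Sum.abs_summable_on ?f ?A"
    using has_sum_imp_summable[OF hs]
    by (rule iffD1[OF abs_summable_equivalent, OF iffD1[OF summable_on_iff_abs_summable_on_real]])
  have "(\<integral>\<^sup>+ y. ennreal (?f y) \<partial>count_space ?A) = ennreal (infsetsum ?f ?A)"
    using abs by (rule nn_integral_conv_infsetsum) (auto intro: nn)
  also have "\<dots> = 1"
    using infsetsum_infsum[OF abs] infsumI[OF hs] by simp
  finally have "(\<integral>\<^sup>+ y. ennreal (?f y) * indicator ?A y \<partial>count_space UNIV) = 1"
    by (simp add: nn_integral_count_space_indicator)
  also have "(\<lambda>y. ennreal (?f y) * indicator ?A y) = (\<lambda>y. ennreal (case y of (s', r) \<Rightarrow>
      if s' \<in> states M \<and> r \<in> rewards M then dyn M s' r x else 0))"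
    by (auto simp: indicator_def)
  finally have "pmf (embed_pmf (\<lambda>(s', r).
      if s' \<in> states M \<and> r \<in> rewards M then dyn M s' r x else 0)) (s', r) =
      (case (s', r) of (s', r) \<Rightarrow>
        if s' \<in> states M \<and> r \<in> rewards M then dyn M s' r x else 0)"
    by (intro pmf_embed_pmf) (simp_all add: nn split: prod.split)
  then show ?thesis by (simp only: outcome_pmf_def prod.case)
qed

definition value_fun ::
  "real \<Rightarrow> ('s, 'a) mdp \<Rightarrow> ('s \<times> 'a \<Rightarrow> real) \<Rightarrow> 's \<Rightarrow> real" where
  "value_fun \<gamma> M \<pi> s = (\<integral>\<omega>. (\<Sum>k. \<gamma> ^ k * fst (snd (\<omega> k))) \<partial>trajectory M \<pi> s)"

definition opt_value :: "real \<Rightarrow> ('s, 'a) mdp \<Rightarrow> 's \<Rightarrow> real" where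
  "opt_value \<gamma> M s = (SUP \<pi>\<in>policies M. value_fun \<gamma> M \<pi> s)"

definition optimal_policies :: "real \<Rightarrow> ('s, 'a) mdp \<Rightarrow> ('s \<times> 'a \<Rightarrow> real) set" where
  "optimal_policies \<gamma> M =
     {\<pi> \<in> policies M. \<forall>s\<in>states M. value_fun \<gamma> M \<pi> s = opt_value \<gamma> M s}"

definition visible_symmetry ::
  "('s, 'a) mdp \<Rightarrow> ('s \<times> 's) set \<Rightarrow> (('s \<times> 'a) \<times> ('s \<times> 'a)) set \<Rightarrow> bool" where
  "visible_symmetry M ES EP \<longleftrightarrow>
     equiv (states M) ES \<and> equiv (pairs M) EP \<and>
     (\<forall>s1 a1 s2. (s1, a1) \<in> pairs M \<and> s2 \<in> states M \<and> (s1, s2) \<in> ES \<longrightarrow>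
        (\<exists>a2\<in>adm M s2. ((s1, a1), (s2, a2)) \<in> EP)) \<and>
     (\<forall>s1 a1 s2 a2. ((s1, a1), (s2, a2)) \<in> EP \<longrightarrow>
        (s1, s2) \<in> ES \<and>
        (\<forall>X\<in>states M // ES. \<forall>r\<in>rewards M. set_prob M X r (s1, a1) = set_prob M X r (s2, a2)))"

definition simple_symmetry :: "(('s \<times> 'a) \<times> ('s \<times> 'a)) set \<Rightarrow> bool" where
  "simple_symmetry EP \<longleftrightarrow> (\<forall>s1 a1 s2 a2. ((s1, a1), (s2, a2)) \<in> EP \<longrightarrow> a1 = a2)"

definition N_pairs ::
  "('s, 'a) mdp \<Rightarrow> (('s \<times> 'a) \<times> ('s \<times> 'a)) set \<Rightarrow> 's \<Rightarrow> 'a \<Rightarrow> nat" where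
  "N_pairs M EP s a = card {a' \<in> adm M s. ((s, a), (s, a')) \<in> EP}"

(* The actions of the quotient are the classes of pairs themselves, and the class of (s, a) is
   admissible exactly in the state class of s. The dynamic is evaluated at a representative;
   for a visible symmetry its value does not depend on the choice. *)
definition quotient_mdp ::
  "('s, 'a) mdp \<Rightarrow> ('s \<times> 's) set \<Rightarrow> (('s \<times> 'a) \<times> ('s \<times> 'a)) set
     \<Rightarrow> ('s set, ('s \<times> 'a) set) mdp" where
  "quotient_mdp M ES EP =
     \<lparr> states = states M // ES,
       actions = pairs M // EP,
       pairs = {(ES `` {s}, EP `` {(s, a)}) | s a. (s, a) \<in> pairs M},
       rewards = rewards M,
       dyn = (\<lambda>X r (Y, c). set_prob M X r (SOME x. x \<in> c)) \<rparr>"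

(* The notation \<pi>(a | X) for a policy of the quotient by a simple symmetry: the value of \<pi> on the
   only pair class belonging to X whose members have action a. *)
definition simple_val ::
  "('s, 'a) mdp \<Rightarrow> (('s \<times> 'a) \<times> ('s \<times> 'a)) set \<Rightarrow> ('s set \<times> ('s \<times> 'a) set \<Rightarrow> real)
     \<Rightarrow> 'a \<Rightarrow> 's set \<Rightarrow> real" where
  "simple_val M EP \<pi> a X = \<pi> (X, THE c. c \<in> pairs M // EP \<and> (\<exists>s\<in>X. (s, a) \<in> c))"

lemma simple_val_eq:
  assumes "visible_symmetry M ES EP" "simple_symmetry EP" "(s, a) \<in> pairs M"
  shows "simple_val M EP \<pi> a (ES `` {s}) = \<pi> (ES `` {s}, EP `` {(s, a)})"
proof -
  have eP: "equiv (pairs M) EP" and eS: "equiv (states M) ES"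
    using assms by (auto simp: visible_symmetry_def)
  have mem: "((s, a), (s, a)) \<in> EP" using eP assms(3) by (meson equiv_def refl_onD)
  then have ss: "(s, s) \<in> ES" using assms(1) by (auto simp: visible_symmetry_def)
  have "(THE c. c \<in> pairs M // EP \<and> (\<exists>t\<in>ES `` {s}. (t, a) \<in> c)) = EP `` {(s, a)}"
  proof (rule the_equality)
    show "EP `` {(s, a)} \<in> pairs M // EP \<and> (\<exists>t\<in>ES `` {s}. (t, a) \<in> EP `` {(s, a)})"
      using mem ss assms(3) by (auto intro: quotientI)
  next
    fix c assume c: "c \<in> pairs M // EP \<and> (\<exists>t\<in>ES `` {s}. (t, a) \<in> c)"
    then obtain t where t: "(s, t) \<in> ES" "(t, a) \<in> c" by auto
    have "t \<in> states M" using eS t(1) by (auto simp: equiv_def)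
    then obtain b where b: "((s, a), (t, b)) \<in> EP"
      using assms(1,3) t(1) unfolding visible_symmetry_def by blast
    then have "b = a" using assms(2) by (auto simp: simple_symmetry_def)
    with b have "(t, a) \<in> EP `` {(s, a)}" by auto
    then show "c = EP `` {(s, a)}"
      using c t(2) quotient_eqI[OF eP, of c "EP `` {(s, a)}" "(t, a)" "(t, a)"] assms(3)
        quotientI[OF assms(3), of EP] quotient_disj[OF eP, of c "EP `` {(s, a)}"] by auto
  qed
  then show ?thesis by (simp add: simple_val_def)
qed

definition relabeling ::
  "('s, 'a) mdp \<Rightarrow> ('t, 'b) mdp \<Rightarrow> ('s \<Rightarrow> 't) \<Rightarrow> ('s \<Rightarrow> 'a \<Rightarrow> 'b) \<Rightarrow> bool" where
  "relabeling M M' f g \<longleftrightarrow>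
     rewards M = rewards M' \<and>
     bij_betw f (states M) (states M') \<and>
     (\<forall>s\<in>states M. bij_betw (g s) (adm M s) (adm M' (f s))) \<and>
     (\<forall>s a s' r. (s, a) \<in> pairs M \<and> s' \<in> states M \<and> r \<in> rewards M \<longrightarrow>
        dyn M s' r (s, a) = dyn M' (f s') r (f s, g s a))"

definition relabeled_variant :: "('s, 'a) mdp \<Rightarrow> ('t, 'b) mdp \<Rightarrow> bool" where
  "relabeled_variant M' M \<longleftrightarrow> (\<exists>f g. relabeling M M' f g)"

definition same_transition_structure :: "('s, 'a) mdp \<Rightarrow> ('s, 'a) mdp \<Rightarrow> bool" where
  "same_transition_structure M M' \<longleftrightarrow>
     states M = states M' \<and> actions M = actions M' \<and> pairs M = pairs M' \<and>
     (\<forall>x\<in>pairs M. \<forall>s'\<in>states M. trans_prob M s' x = trans_prob M' s' x)"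

definition same_trans_opt :: "real \<Rightarrow> ('s, 'a) mdp \<Rightarrow> ('s, 'a) mdp \<Rightarrow> bool" where
  "same_trans_opt \<gamma> M M' \<longleftrightarrow>
     same_transition_structure M M' \<and> optimal_policies \<gamma> M = optimal_policies \<gamma> M'"

(* Both MDPs live over the same types because the second case compares their state and action
   sets for equality. The sets themselves remain arbitrary subsets of these types. *)
definition equivalent_mdps :: "real \<Rightarrow> ('s, 'a) mdp \<Rightarrow> ('s, 'a) mdp \<Rightarrow> bool" where
  "equivalent_mdps \<gamma> M M' \<longleftrightarrow>
     relabeled_variant M' M \<or>
     same_trans_opt \<gamma> M M' \<or>
     (\<exists>Mt. is_mdp Mt \<and> relabeled_variant Mt M \<and> same_trans_opt \<gamma> Mt M') \<or>
     (\<exists>Mt. is_mdp Mt \<and> same_trans_opt \<gamma> M Mt \<and> relabeled_variant M' Mt)"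

definition equivalence_relabeling ::
  "real \<Rightarrow> ('s, 'a) mdp \<Rightarrow> ('s, 'a) mdp \<Rightarrow> ('s \<Rightarrow> 's) \<Rightarrow> ('s \<Rightarrow> 'a \<Rightarrow> 'a) \<Rightarrow> bool" where
  "equivalence_relabeling \<gamma> M M' f g \<longleftrightarrow>
     relabeling M M' f g \<or>
     (same_trans_opt \<gamma> M M' \<and> (\<forall>s\<in>states M. f s = s \<and> (\<forall>a\<in>adm M s. g s a = a))) \<or>
     (\<exists>Mt. is_mdp Mt \<and> relabeling M Mt f g \<and> same_trans_opt \<gamma> Mt M') \<or>
     (\<exists>Mt. is_mdp Mt \<and> same_trans_opt \<gamma> M Mt \<and> relabeling Mt M' f g)"

definition hidden_symmetry ::
  "real \<Rightarrow> ('s, 'a) mdp \<Rightarrow> ('s, 'a) mdp \<Rightarrow> ('s \<times> 's) set \<Rightarrow> (('s \<times> 'a) \<times> ('s \<times> 'a)) set \<Rightarrow> bool" where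
  "hidden_symmetry \<gamma> M M' ES EP \<longleftrightarrow>
     equivalent_mdps \<gamma> M M' \<and> visible_symmetry M' ES EP"

definition pullback ::
  "('s, 'a) mdp \<Rightarrow> ('t, 'b) mdp \<Rightarrow> ('t \<times> 't) set \<Rightarrow> (('t \<times> 'b) \<times> ('t \<times> 'b)) set
     \<Rightarrow> ('s \<Rightarrow> 't) \<Rightarrow> ('s \<Rightarrow> 'a \<Rightarrow> 'b) \<Rightarrow> ('t set \<times> ('t \<times> 'b) set \<Rightarrow> real) \<Rightarrow> 's \<times> 'a \<Rightarrow> real" where
  "pullback M M' ES EP f g \<pi> =
     (\<lambda>(s, a)\<in>pairs M.
        \<pi> (ES `` {f s}, EP `` {(f s, g s a)}) / real (N_pairs M' EP (f s) (g s a)))"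

end

theory Submission
  imports Defs
begin

text \<open>
  Optimality of a policy can be recognized one step at a time. The value \<open>V\<close> of an optimal policy
  satisfies the Bellman equation of that policy, and no single admissible action followed by the
  payout \<open>V\<close> earns more than \<open>V\<close> (\<open>optimal_policy_action_value_le\<close>). Conversely, any bounded
  function with these two properties is the optimal value, and the policy attains it
  (\<open>optimal_policyI\<close>). Both directions rest on one monotonicity argument: if the Bellman update of
  a bounded function \<open>W\<close> lies above (below) \<open>W\<close>, then the expected returns of play that stops after
  \<open>n\<close> steps with payout \<open>W\<close> increase (decrease) with \<open>n\<close> and converge to the value of the policy.

  Both properties speak only about the outcome laws of single actions, so they travel along maps
  of processes that transport these laws. If \<open>f\<close>, \<open>g\<close> is such a map from \<open>M\<close> to \<open>N\<close>, surjective on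
  the actions of each state, and \<open>V\<close> is the optimal value in \<open>N\<close>, then \<open>V \<circ> f\<close> has the two
  properties for every policy of \<open>M\<close> that distributes the weight of each action of \<open>N\<close> over its
  preimages (\<open>optimal_policy_along_homomorphism\<close>). In particular the comparison is with all policies
  of \<open>M\<close>, including those that do not respect the symmetry.

  The quotient map of a visible symmetry and every relabeling are maps of this kind. Dividing by
  the number of equivalent actions spreads the weight of a pair class evenly over a fibre, so the
  pullback is optimal in \<open>M'\<close>; the renaming, together with the equality of the sets of optimal
  policies in the remaining part of an equivalence, carries it to \<open>M\<close>. For a simple symmetry the
  fibres are singletons and no division remains.
\<close>

section \<open>Bounded functions and probability mass functions\<close>

text \<open>
  Rewards and value functions are bounded only on the rewards and states of the process, not on
  the whole ambient type. Hence the bound is required only on the support, and the general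
  theorem on integrals over a bind is applied to \<open>h\<close> cut off outside the bound.
\<close>

lemma expectation_bind_pmf:
  fixes h :: "'b \<Rightarrow> real"
  assumes "\<And>x y. x \<in> set_pmf p \<Longrightarrow> y \<in> set_pmf (N x) \<Longrightarrow> \<bar>h y\<bar> \<le> B"
  shows "measure_pmf.expectation (bind_pmf p N) h =
    measure_pmf.expectation p (\<lambda>x. measure_pmf.expectation (N x) h)"
proof -
  define h' where "h' y = (if \<bar>h y\<bar> \<le> B then h y else 0)" for y
  have bd: "\<bar>h' y\<bar> \<le> \<bar>B\<bar>" for y
    by (auto simp: h'_def)
  have "measure_pmf.expectation (bind_pmf p N) h = measure_pmf.expectation (bind_pmf p N) h'"
    by (rule integral_cong_AE) (auto simp: AE_measure_pmf_iff h'_def dest: assms)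
  also have "\<dots> = measure_pmf.expectation p (\<lambda>x. measure_pmf.expectation (N x) h')"
    unfolding measure_pmf_bind
  proof (rule integral_bind[where K = "count_space UNIV" and B = "\<bar>B\<bar>" and B' = 1])
    show "(\<lambda>x. measure_pmf (N x)) \<in> measurable (measure_pmf p) (subprob_algebra (count_space UNIV))"
      using measurable_measure_pmf[of N] by (simp add: measurable_cong_sets)
  qed (auto simp: bd measure_pmf.emeasure_space_1 intro!: measure_pmf.finite_measure_axioms)
  also have "\<dots> = measure_pmf.expectation p (\<lambda>x. measure_pmf.expectation (N x) h)"
    by (intro integral_cong_AE) (auto simp: AE_measure_pmf_iff h'_def dest: assms intro!: integral_cong_AE)
  finally show ?thesis .
qed

lemma integrable_pmf_bounded:
  fixes h :: "'b \<Rightarrow> real"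
  assumes "\<And>y. y \<in> set_pmf p \<Longrightarrow> \<bar>h y\<bar> \<le> B"
  shows "integrable p h"
  by (rule measure_pmf.integrable_const_bound[where B = B]) (auto simp: AE_measure_pmf_iff assms)

lemma abs_expectation_le:
  fixes h :: "'b \<Rightarrow> real"
  assumes "\<And>y. y \<in> set_pmf p \<Longrightarrow> \<bar>h y\<bar> \<le> B"
  shows "\<bar>measure_pmf.expectation p h\<bar> \<le> B"
proof -
  have int: "integrable p h"
    by (rule integrable_pmf_bounded[OF assms])
  have "measure_pmf.expectation p h \<le> measure_pmf.expectation p (\<lambda>_. B)"
    by (rule integral_mono_AE[OF int]) (auto simp: AE_measure_pmf_iff abs_le_iff dest: assms)
  moreover have "measure_pmf.expectation p (\<lambda>_. - B) \<le> measure_pmf.expectation p h"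
    by (rule integral_mono_AE[OF _ int]) (auto simp: AE_measure_pmf_iff abs_le_iff dest!: assms)
  ultimately show ?thesis by (simp add: abs_le_iff)
qed

section \<open>Marginals of the trajectory measure\<close>

text \<open>
  The law of \<open>S\<^sub>n\<close> as a probability mass function. Only these one-dimensional marginals of the
  trajectory measure enter the expected discounted reward.
\<close>

primrec state_law :: "('s, 'a) mdp \<Rightarrow> ('s \<times> 'a \<Rightarrow> real) \<Rightarrow> 's \<Rightarrow> nat \<Rightarrow> 's pmf" where
  "state_law M \<pi> s 0 = return_pmf s"
| "state_law M \<pi> s (Suc n) =
     bind_pmf (state_law M \<pi> s n) (\<lambda>t. map_pmf (\<lambda>x. snd (snd x)) (step_pmf M \<pi> t))"

text \<open>
  The defining recursion appends a last step; conditioning on the first step gives the same law.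
  This is the Markov property at time one, and the source of the Bellman equation.
\<close>

lemma state_law_first_step:
  "state_law M \<pi> s (Suc n) = bind_pmf (step_pmf M \<pi> s) (\<lambda>x. state_law M \<pi> (snd (snd x)) n)"
proof (induction n)
  case 0
  then show ?case by (simp add: bind_return_pmf map_pmf_def)
next
  case (Suc n)
  have "state_law M \<pi> s (Suc (Suc n)) =
      bind_pmf (state_law M \<pi> s (Suc n)) (\<lambda>t. map_pmf (\<lambda>x. snd (snd x)) (step_pmf M \<pi> t))"
    by simp
  also have "\<dots> = bind_pmf (step_pmf M \<pi> s) (\<lambda>x. state_law M \<pi> (snd (snd x)) (Suc n))"
    unfolding Suc by (simp add: bind_assoc_pmf)
  finally show ?case .
qed

text \<open>
  The kernels see the past only through its last state, so the law of \<open>S\<^sub>n\<close> under the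
  finite-horizon product measures satisfies the recursion of \<open>state_law\<close>. The induction is on
  the first equation; the second, applied to a function of the new state, is its step.
\<close>

lemma nn_integral_initial_segment:
  fixes M :: "('s, 'a) mdp" and \<pi> s
  defines "C \<equiv> Ionescu_Tulcea.C (kernel M \<pi> s) (\<lambda>_. count_space UNIV) 0"
  shows "(\<integral>\<^sup>+\<omega>. h (state_at s \<omega> n) \<partial>C n (\<lambda>_. undefined)) = (\<integral>\<^sup>+t. h t \<partial>state_law M \<pi> s n)"
    and "(\<integral>\<^sup>+\<omega>. k (\<omega> n) \<partial>C (Suc n) (\<lambda>_. undefined)) =
      (\<integral>\<^sup>+t. (\<integral>\<^sup>+x. k x \<partial>step_pmf M \<pi> t) \<partial>state_law M \<pi> s n)"
proof -
  interpret IT: Ionescu_Tulcea "kernel M \<pi> s" "\<lambda>_. count_space UNIV"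
    by (rule Ionescu_Tulcea_kernel)
  have step: "(\<integral>\<^sup>+\<omega>. k (\<omega> n) \<partial>C (Suc n) (\<lambda>_. undefined)) =
      (\<integral>\<^sup>+\<omega>. (\<integral>\<^sup>+x. k x \<partial>step_pmf M \<pi> (state_at s \<omega> n)) \<partial>C n (\<lambda>_. undefined))" for n k
  proof -
    have m: "(\<lambda>\<omega>. k (\<omega> n)) \<in> borel_measurable (PiM {0..<Suc n} (\<lambda>_. count_space UNIV))"
      by (rule measurable_compose[OF measurable_component_singleton]) auto
    have sp: "space (C n (\<lambda>_. undefined)) = space (PiM {0..<n} (\<lambda>_. count_space UNIV))"
      unfolding C_def using IT.space_C[of "\<lambda>_. undefined" 0 n] by simp
    have st: "sets (C n (\<lambda>_. undefined)) = sets (PiM {0..<n} (\<lambda>_. count_space UNIV))"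
      unfolding C_def using IT.sets_C[of "\<lambda>_. undefined" 0 n] by simp
    have "(\<integral>\<^sup>+\<omega>. k (\<omega> n) \<partial>C (Suc n) (\<lambda>_. undefined)) =
        (\<integral>\<^sup>+\<omega>. (\<integral>\<^sup>+\<omega>'. k (\<omega>' n) \<partial>IT.eP n \<omega>) \<partial>C n (\<lambda>_. undefined))"
      unfolding C_def IT.C.simps add_0
      by (rule nn_integral_bind[OF m])
        (use IT.measurable_eP in \<open>simp add: measurable_cong_sets[OF st[unfolded C_def] refl]\<close>)
    also have "\<dots> = (\<integral>\<^sup>+\<omega>. (\<integral>\<^sup>+x. k x \<partial>step_pmf M \<pi> (state_at s \<omega> n)) \<partial>C n (\<lambda>_. undefined))"
      by (intro nn_integral_cong) (simp add: sp IT.nn_integral_eP[OF _ m] kernel_def)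
    finally show ?thesis .
  qed
  have law: "(\<integral>\<^sup>+\<omega>. h (state_at s \<omega> n) \<partial>C n (\<lambda>_. undefined)) = (\<integral>\<^sup>+t. h t \<partial>state_law M \<pi> s n)" for h n
  proof (induction n arbitrary: h)
    case 0
    then show ?case
      by (simp add: C_def nn_integral_return space_PiM PiM_empty nn_integral_count_space_finite)
  next
    case (Suc n)
    show ?case
      using Suc step[where k = "\<lambda>x. h (snd (snd x))" and n = n] by simp
  qed
  show "(\<integral>\<^sup>+\<omega>. h (state_at s \<omega> n) \<partial>C n (\<lambda>_. undefined)) = (\<integral>\<^sup>+t. h t \<partial>state_law M \<pi> s n)"
    by (rule law)
  show "(\<integral>\<^sup>+\<omega>. k (\<omega> n) \<partial>C (Suc n) (\<lambda>_. undefined)) =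
      (\<integral>\<^sup>+t. (\<integral>\<^sup>+x. k x \<partial>step_pmf M \<pi> t) \<partial>state_law M \<pi> s n)"
    unfolding step by (rule law)
qed

lemma
  shows prob_space_trajectory: "prob_space (trajectory M \<pi> s)"
    and measurable_trajectory_coordinate [measurable]:
      "(\<lambda>\<omega>. \<omega> n) \<in> measurable (trajectory M \<pi> s) (count_space UNIV)"
    and distr_trajectory_coordinate: "distr (trajectory M \<pi> s) (count_space UNIV) (\<lambda>\<omega>. \<omega> n) =
      measure_pmf (bind_pmf (state_law M \<pi> s n) (step_pmf M \<pi>))"
proof -
  interpret IT: Ionescu_Tulcea "kernel M \<pi> s" "\<lambda>_. count_space UNIV"
    by (rule Ionescu_Tulcea_kernel)
  let ?P = "\<lambda>J. PiM J (\<lambda>_::nat. count_space UNIV)"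
  have T: "trajectory M \<pi> s = IT.PF.lim"
    by (simp add: trajectory_def)
  have sets: "sets (trajectory M \<pi> s) = sets (?P UNIV)"
    by (simp add: T)
  show meas: "(\<lambda>\<omega>. \<omega> n) \<in> measurable (trajectory M \<pi> s) (count_space UNIV)" for n
    unfolding measurable_cong_sets[OF sets refl] by (rule measurable_component_singleton) simp
  have restr: "(\<lambda>\<omega>. restrict \<omega> J) \<in> measurable (trajectory M \<pi> s) (?P J)" for J
    unfolding measurable_cong_sets[OF sets refl] by (rule measurable_restrict_subset) simp
  have fd: "distr (trajectory M \<pi> s) (?P {0..<n}) (\<lambda>\<omega>. restrict \<omega> {0..<n}) = IT.C 0 n (\<lambda>_. undefined)" for n
  proof -
    have "IT.up_to {0..<n} = n"
      using IT.up_to_iff[of "{0..<n}"] by (metis atLeastLessThan_iff finite_atLeastLessThan le_antisym le_refl linorder_not_less zero_le)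
    then have "IT.CI {0..<n} = distr (IT.C 0 n (\<lambda>_. undefined)) (?P {0..<n}) (\<lambda>f. restrict f {0..<n})"
      by (simp add: IT.CI_def)
    also have "\<dots> = IT.C 0 n (\<lambda>_. undefined)"
      using IT.distr_C[of n n "\<lambda>_. undefined" 0] by simp
    finally show ?thesis
      unfolding T by (simp add: IT.distr_lim)
  qed
  \<comment> \<open>The projection to no coordinate at all is already a probability measure, hence so is the
    measure that it projects.\<close>
  have "prob_space (IT.C 0 0 (\<lambda>_. undefined))"
    by (rule IT.prob_space_C) simp
  then have "prob_space (distr (trajectory M \<pi> s) (?P {0..<0}) (\<lambda>\<omega>. restrict \<omega> {0..<0}))"
    by (simp only: fd)
  then show "prob_space (trajectory M \<pi> s)"
    by (rule prob_space_distrD[OF restr])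
  show "distr (trajectory M \<pi> s) (count_space UNIV) (\<lambda>\<omega>. \<omega> n) =
      measure_pmf (bind_pmf (state_law M \<pi> s n) (step_pmf M \<pi>))"
  proof (rule measure_eqI)
    fix A assume "A \<in> sets (distr (trajectory M \<pi> s) (count_space UNIV) (\<lambda>\<omega>. \<omega> n))"
    have comp: "(\<lambda>\<omega>. \<omega> n) \<in> measurable (?P {0..<Suc n}) (count_space UNIV)"
      by (rule measurable_component_singleton) simp
    have "emeasure (distr (trajectory M \<pi> s) (count_space UNIV) (\<lambda>\<omega>. \<omega> n)) A =
        (\<integral>\<^sup>+\<omega>. indicator A (\<omega> n) \<partial>trajectory M \<pi> s)"
      using nn_integral_distr[OF meas, of "indicator A" n] by simp
    also have "\<dots> = (\<integral>\<^sup>+\<omega>. indicator A (\<omega> n) \<partial>IT.C 0 (Suc n) (\<lambda>_. undefined))"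
      unfolding fd[symmetric]
      by (subst nn_integral_distr[OF restr]) (auto intro!: measurable_compose[OF comp])
    also have "\<dots> = emeasure (bind_pmf (state_law M \<pi> s n) (step_pmf M \<pi>)) A"
      by (subst nn_integral_initial_segment(2)) simp
    finally show "emeasure (distr (trajectory M \<pi> s) (count_space UNIV) (\<lambda>\<omega>. \<omega> n)) A = \<dots>" .
  qed simp
qed

section \<open>Value functions and the Bellman operator\<close>

text \<open>
  The expected return of one action whose outcome is then evaluated by \<open>W\<close>. For \<open>W = V\<^sub>\<pi>\<close> this is
  the action-value function usually written \<open>q\<^sub>\<pi>(s, a)\<close>.
\<close>

definition action_value ::
  "real \<Rightarrow> ('s, 'a) mdp \<Rightarrow> ('s \<Rightarrow> real) \<Rightarrow> 's \<times> 'a \<Rightarrow> real" where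
  "action_value \<gamma> M W x = measure_pmf.expectation (outcome_pmf M x) (\<lambda>(s', r). r + \<gamma> * W s')"

definition bellman ::
  "real \<Rightarrow> ('s, 'a) mdp \<Rightarrow> ('s \<times> 'a \<Rightarrow> real) \<Rightarrow> ('s \<Rightarrow> real) \<Rightarrow> 's \<Rightarrow> real" where
  "bellman \<gamma> M \<pi> W s = (\<Sum>a\<in>adm M s. \<pi> (s, a) * action_value \<gamma> M W (s, a))"

definition mean_reward :: "('s, 'a) mdp \<Rightarrow> ('s \<times> 'a \<Rightarrow> real) \<Rightarrow> 's \<Rightarrow> real" where
  "mean_reward M \<pi> s = measure_pmf.expectation (step_pmf M \<pi> s) (\<lambda>x. fst (snd x))"

lemma mem_pairs_iff: "is_mdp M \<Longrightarrow> (s, a) \<in> pairs M \<longleftrightarrow> s \<in> states M \<and> a \<in> adm M s"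
  by (auto simp: is_mdp_def adm_def)

lemma set_outcome_pmf:
  assumes "is_mdp M" "x \<in> pairs M"
  shows "set_pmf (outcome_pmf M x) \<subseteq> states M \<times> rewards M"
  using assms by (auto simp: set_pmf_iff pmf_outcome_pmf split: if_splits)

lemma rewards_bound:
  assumes "is_mdp M"
  obtains B where "0 \<le> B" "\<And>r. r \<in> rewards M \<Longrightarrow> \<bar>r\<bar> \<le> B"
proof -
  have "bounded (rewards M)"
    using assms by (simp add: is_mdp_def)
  then obtain B where "0 < B" "\<forall>r\<in>rewards M. \<bar>r\<bar> \<le> B"
    by (auto simp: bounded_pos)
  then show ?thesis
    by (intro that[of B]) auto
qed

locale discounted_policy =
  fixes M :: "('s, 'a) mdp" and \<pi> :: "'s \<times> 'a \<Rightarrow> real" and \<gamma> :: real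
  assumes mdp: "is_mdp M"
    and policy: "\<pi> \<in> policies M"
    and discount_nonneg: "0 \<le> \<gamma>"
    and discount_less_1: "\<gamma> < 1"
begin

lemma policy_nonneg: "s \<in> states M \<Longrightarrow> a \<in> adm M s \<Longrightarrow> 0 \<le> \<pi> (s, a)"
  using policy by (auto simp: adm_def policies_def dest!: PiE_mem)

lemma set_step_pmf:
  assumes "s \<in> states M" "x \<in> set_pmf (step_pmf M \<pi> s)"
  shows "fst x \<in> adm M s" "fst (snd x) \<in> rewards M" "snd (snd x) \<in> states M"
proof -
  obtain a r s' where a: "a \<in> set_pmf (action_pmf M \<pi> s)"
    and out: "(s', r) \<in> set_pmf (outcome_pmf M (s, a))" and x: "x = (a, r, s')"
    using assms(2) by (auto simp: step_pmf_def)
  have adm: "a \<in> adm M s"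
    using a by (auto simp: set_pmf_iff pmf_action_pmf[OF mdp policy assms(1)] split: if_splits)
  then show "fst x \<in> adm M s" "fst (snd x) \<in> rewards M" "snd (snd x) \<in> states M"
    using x out set_outcome_pmf[OF mdp, of "(s, a)"] assms(1) by (auto simp: mem_pairs_iff[OF mdp])
qed

lemma set_state_law:
  assumes "s \<in> states M"
  shows "set_pmf (state_law M \<pi> s n) \<subseteq> states M"
  by (induction n) (use assms set_step_pmf(3) in auto)

text \<open>
  Conditioning one step on its action turns an expectation into a finite sum weighted by the
  policy. This connects the probabilistic description of a step with the Bellman operator.
\<close>

lemma expectation_step_pmf:
  assumes s: "s \<in> states M"
    and bd: "\<And>a r s'. r \<in> rewards M \<Longrightarrow> s' \<in> states M \<Longrightarrow> \<bar>h (a, r, s')\<bar> \<le> B"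
  shows "measure_pmf.expectation (step_pmf M \<pi> s) h =
    (\<Sum>a\<in>adm M s. \<pi> (s, a) *
      measure_pmf.expectation (outcome_pmf M (s, a)) (\<lambda>(s', r). h (a, r, s')))"
proof -
  have supp: "set_pmf (action_pmf M \<pi> s) \<subseteq> adm M s"
    by (auto simp: set_pmf_iff pmf_action_pmf[OF mdp policy s] split: if_splits)
  have "measure_pmf.expectation (step_pmf M \<pi> s) h =
    measure_pmf.expectation (action_pmf M \<pi> s) (\<lambda>a.
      measure_pmf.expectation (map_pmf (\<lambda>(s', r). (a, r, s')) (outcome_pmf M (s, a))) h)"
    unfolding step_pmf_def
  proof (rule expectation_bind_pmf)
    fix a y
    assume "a \<in> set_pmf (action_pmf M \<pi> s)"
      "y \<in> set_pmf (map_pmf (\<lambda>(s', r). (a, r, s')) (outcome_pmf M (s, a)))"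
    then have "y \<in> set_pmf (step_pmf M \<pi> s)"
      by (auto simp: step_pmf_def)
    from set_step_pmf[OF s this] show "\<bar>h y\<bar> \<le> B"
      by (cases y) (auto intro: bd)
  qed
  also have "\<dots> = measure_pmf.expectation (action_pmf M \<pi> s) (\<lambda>a.
      measure_pmf.expectation (outcome_pmf M (s, a)) (\<lambda>(s', r). h (a, r, s')))"
    by (simp add: case_prod_beta')
  also have "\<dots> = (\<Sum>a\<in>adm M s.
      measure_pmf.expectation (outcome_pmf M (s, a)) (\<lambda>(s', r). h (a, r, s')) *
      pmf (action_pmf M \<pi> s) a)"
    by (rule integral_measure_pmf_real) (use mdp s supp in \<open>auto simp: is_mdp_def\<close>)
  also have "\<dots> = (\<Sum>a\<in>adm M s. \<pi> (s, a) *
      measure_pmf.expectation (outcome_pmf M (s, a)) (\<lambda>(s', r). h (a, r, s')))"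
    by (intro sum.cong) (auto simp: pmf_action_pmf[OF mdp policy s])
  finally show ?thesis .
qed

lemma bellman_eq_expectation:
  assumes "s \<in> states M" and W: "\<And>t. t \<in> states M \<Longrightarrow> \<bar>W t\<bar> \<le> C"
  shows "bellman \<gamma> M \<pi> W s =
    mean_reward M \<pi> s + \<gamma> * measure_pmf.expectation (step_pmf M \<pi> s) (\<lambda>x. W (snd (snd x)))"
proof -
  obtain B where B: "\<And>r. r \<in> rewards M \<Longrightarrow> \<bar>r\<bar> \<le> B"
    using rewards_bound[OF mdp] by metis
  have integrable_step: "integrable (step_pmf M \<pi> s) h"
    if "\<And>x. fst (snd x) \<in> rewards M \<Longrightarrow> snd (snd x) \<in> states M \<Longrightarrow> \<bar>h x\<bar> \<le> D" for h :: "_ \<Rightarrow> real" and D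
    by (rule integrable_pmf_bounded[where B = D]) (rule that[OF set_step_pmf(2,3)[OF assms(1)]])
  have "\<bar>\<gamma> * W t\<bar> \<le> \<gamma> * C" if "t \<in> states M" for t
    using W[OF that] discount_nonneg by (simp add: abs_mult mult_left_mono)
  then have "bellman \<gamma> M \<pi> W s =
      measure_pmf.expectation (step_pmf M \<pi> s) (\<lambda>x. fst (snd x) + \<gamma> * W (snd (snd x)))"
    unfolding bellman_def action_value_def
    by (subst expectation_step_pmf[OF assms(1), where B = "B + \<gamma> * C"])
      (auto intro: order_trans[OF abs_triangle_ineq add_mono] B)
  also have "\<dots> =
    mean_reward M \<pi> s + \<gamma> * measure_pmf.expectation (step_pmf M \<pi> s) (\<lambda>x. W (snd (snd x)))"
    unfolding mean_reward_def
    by (subst Bochner_Integration.integral_add)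
      (use integrable_step[of "\<lambda>x. fst (snd x)" B] integrable_step[of "\<lambda>x. W (snd (snd x))" C]
        B W in \<open>auto intro: integrable_mult_right\<close>)
  finally show ?thesis .
qed

lemma abs_mean_reward_le:
  assumes "s \<in> states M" "\<And>r. r \<in> rewards M \<Longrightarrow> \<bar>r\<bar> \<le> B"
  shows "\<bar>mean_reward M \<pi> s\<bar> \<le> B"
  unfolding mean_reward_def by (rule abs_expectation_le) (auto intro: assms set_step_pmf)

lemma summable_discounted:
  assumes "\<And>k. \<bar>x k\<bar> \<le> B"
  shows "summable (\<lambda>k. \<gamma> ^ k * x k)"
proof (rule summable_comparison_test[OF _ summable_mult2[OF summable_geometric]])
  show "\<exists>N. \<forall>n\<ge>N. norm (\<gamma> ^ n * x n) \<le> \<gamma> ^ n * B"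
    using assms discount_nonneg by (auto simp: abs_mult intro!: mult_left_mono)
qed (use discount_nonneg discount_less_1 in simp)

text \<open>
  Since rewards are bounded and \<open>\<gamma> < 1\<close>, the expectation passes through the discounted sum, and
  each summand depends only on the marginal law of \<open>S\<^sub>k\<close>. From here on a value is a discounted
  sum of numbers computed from probability mass functions.
\<close>

lemma value_fun_eq_suminf:
  assumes s: "s \<in> states M"
  shows "value_fun \<gamma> M \<pi> s =
    (\<Sum>k. \<gamma> ^ k * measure_pmf.expectation (state_law M \<pi> s k) (mean_reward M \<pi>))"
proof -
  obtain B where B: "0 \<le> B" "\<And>r. r \<in> rewards M \<Longrightarrow> \<bar>r\<bar> \<le> B"
    using rewards_bound[OF mdp] by metis
  interpret T: prob_space "trajectory M \<pi> s"
    by (rule prob_space_trajectory)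
  have coord: "(\<lambda>\<omega>. fst (snd (\<omega> k))) \<in> borel_measurable (trajectory M \<pi> s)" for k
    by (rule measurable_compose[OF measurable_trajectory_coordinate]) simp
  have supp: "fst (snd x) \<in> rewards M"
    if x: "x \<in> set_pmf (bind_pmf (state_law M \<pi> s k) (step_pmf M \<pi>))" for x k
  proof -
    obtain t where "t \<in> set_pmf (state_law M \<pi> s k)" "x \<in> set_pmf (step_pmf M \<pi> t)"
      using x by auto
    then show ?thesis using set_state_law[OF s, of k] by (auto intro: set_step_pmf(2))
  qed
  have "AE x in distr (trajectory M \<pi> s) (count_space UNIV) (\<lambda>\<omega>. \<omega> k). \<bar>fst (snd x)\<bar> \<le> B" for k
    unfolding distr_trajectory_coordinate by (intro AE_pmfI B supp)
  then have bound: "AE \<omega> in trajectory M \<pi> s. \<bar>fst (snd (\<omega> k))\<bar> \<le> B" for k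
    by (subst (asm) AE_distr_iff) auto
  have term_bound: "AE \<omega> in trajectory M \<pi> s. \<bar>\<gamma> ^ k * fst (snd (\<omega> k))\<bar> \<le> \<gamma> ^ k * B" for k
    using bound[of k] by eventually_elim (use discount_nonneg in \<open>simp add: abs_mult mult_left_mono\<close>)
  have int: "integrable (trajectory M \<pi> s) (\<lambda>\<omega>. \<gamma> ^ k * fst (snd (\<omega> k)))" for k
    by (rule T.integrable_const_bound[where B = "\<gamma> ^ k * B"]) (use term_bound coord in auto)
  have mean: "(\<integral>\<omega>. fst (snd (\<omega> k)) \<partial>trajectory M \<pi> s) =
      measure_pmf.expectation (state_law M \<pi> s k) (mean_reward M \<pi>)" for k
  proof -
    have "(\<integral>\<omega>. fst (snd (\<omega> k)) \<partial>trajectory M \<pi> s) =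
        (\<integral>x. fst (snd x) \<partial>distr (trajectory M \<pi> s) (count_space UNIV) (\<lambda>\<omega>. \<omega> k))"
      by (rule integral_distr[symmetric]) auto
    also have "\<dots> = measure_pmf.expectation (state_law M \<pi> s k) (mean_reward M \<pi>)"
      unfolding distr_trajectory_coordinate mean_reward_def
      by (rule expectation_bind_pmf) (use set_state_law[OF s] B in \<open>auto intro: set_step_pmf\<close>)
    finally show ?thesis .
  qed
  \<comment> \<open>The geometric series dominates both the rewards along almost every trajectory and their means.\<close>
  have geo: "summable (\<lambda>k. \<gamma> ^ k * B)"
    using discount_nonneg discount_less_1 by (intro summable_mult2 summable_geometric) simp
  have "value_fun \<gamma> M \<pi> s = (\<Sum>k. \<integral>\<omega>. \<gamma> ^ k * fst (snd (\<omega> k)) \<partial>trajectory M \<pi> s)"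
    unfolding value_fun_def
  proof (rule integral_suminf[OF int])
    have "AE \<omega> in trajectory M \<pi> s. \<forall>k. \<bar>\<gamma> ^ k * fst (snd (\<omega> k))\<bar> \<le> \<gamma> ^ k * B"
      using term_bound by (simp add: AE_all_countable)
    then show "AE \<omega> in trajectory M \<pi> s. summable (\<lambda>k. norm (\<gamma> ^ k * fst (snd (\<omega> k))))"
      by eventually_elim (rule summable_comparison_test[OF _ geo], simp)
    have "(\<integral>\<omega>. \<bar>\<gamma> ^ k * fst (snd (\<omega> k))\<bar> \<partial>trajectory M \<pi> s) \<le>
        (\<integral>\<omega>. \<gamma> ^ k * B \<partial>trajectory M \<pi> s)" for k
      by (rule integral_mono_AE) (use int term_bound in \<open>auto intro: integrable_abs\<close>)
    then show "summable (\<lambda>k. \<integral>\<omega>. norm (\<gamma> ^ k * fst (snd (\<omega> k))) \<partial>trajectory M \<pi> s)"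
      by (intro summable_comparison_test[OF _ geo]) (auto simp: T.prob_space)
  qed
  then show ?thesis
    by (simp add: mean)
qed

lemma abs_mean_reward_law_le:
  assumes "s \<in> states M" "\<And>r. r \<in> rewards M \<Longrightarrow> \<bar>r\<bar> \<le> B"
  shows "\<bar>measure_pmf.expectation (state_law M \<pi> s k) (mean_reward M \<pi>)\<bar> \<le> B"
  by (rule abs_expectation_le)
    (use set_state_law[OF assms(1)] abs_mean_reward_le assms(2) in auto)

lemma value_fun_bounded:
  obtains C where "\<And>\<sigma> s. \<sigma> \<in> policies M \<Longrightarrow> s \<in> states M \<Longrightarrow> \<bar>value_fun \<gamma> M \<sigma> s\<bar> \<le> C"
proof -
  obtain B where B: "0 \<le> B" "\<And>r. r \<in> rewards M \<Longrightarrow> \<bar>r\<bar> \<le> B"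
    using rewards_bound[OF mdp] by metis
  have "\<bar>value_fun \<gamma> M \<sigma> s\<bar> \<le> (\<Sum>k. \<gamma> ^ k * B)" if "\<sigma> \<in> policies M" "s \<in> states M" for \<sigma> s
  proof -
    interpret \<sigma>: discounted_policy M \<sigma> \<gamma>
      using that mdp discount_nonneg discount_less_1 by unfold_locales
    let ?x = "\<lambda>k. \<gamma> ^ k * measure_pmf.expectation (state_law M \<sigma> s k) (mean_reward M \<sigma>)"
    have le: "norm (?x k) \<le> \<gamma> ^ k * B" for k
      using \<sigma>.abs_mean_reward_law_le[OF that(2) B(2), of k] discount_nonneg
      by (simp add: abs_mult mult_left_mono)
    have geo: "summable (\<lambda>k. \<gamma> ^ k * B)"
      using B(1) by (intro summable_discounted[of _ B]) simp
    have "norm (suminf ?x) \<le> (\<Sum>k. norm (?x k))"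
      by (intro summable_norm summable_comparison_test[OF _ geo]) (use le in auto)
    also have "\<dots> \<le> (\<Sum>k. \<gamma> ^ k * B)"
      by (rule suminf_le[OF le _ geo], rule summable_comparison_test[OF _ geo]) (use le in auto)
    finally show ?thesis
      by (simp add: \<sigma>.value_fun_eq_suminf[OF that(2)])
  qed
  then show ?thesis by (rule that)
qed

text \<open>
  The expected return when play stops after \<open>n\<close> steps and the state reached is paid out by \<open>W\<close>,
  that is, the \<open>n\<close>-th iterate of the Bellman operator applied to \<open>W\<close>.
\<close>

definition truncated_value :: "('s \<Rightarrow> real) \<Rightarrow> 's \<Rightarrow> nat \<Rightarrow> real" where
  "truncated_value W s n =
     (\<Sum>k<n. \<gamma> ^ k * measure_pmf.expectation (state_law M \<pi> s k) (mean_reward M \<pi>)) +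
     \<gamma> ^ n * measure_pmf.expectation (state_law M \<pi> s n) W"

lemma truncated_value_tendsto:
  assumes s: "s \<in> states M" and W: "\<And>t. t \<in> states M \<Longrightarrow> \<bar>W t\<bar> \<le> C"
  shows "truncated_value W s \<longlonglongrightarrow> value_fun \<gamma> M \<pi> s"
proof -
  obtain B where B: "\<And>r. r \<in> rewards M \<Longrightarrow> \<bar>r\<bar> \<le> B"
    using rewards_bound[OF mdp] by metis
  have "(\<lambda>n. \<Sum>k<n. \<gamma> ^ k * measure_pmf.expectation (state_law M \<pi> s k) (mean_reward M \<pi>))
      \<longlonglongrightarrow> value_fun \<gamma> M \<pi> s"
    unfolding value_fun_eq_suminf[OF s]
    by (intro summable_LIMSEQ summable_discounted[of _ B] abs_mean_reward_law_le s B)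
  moreover have "(\<lambda>n. \<gamma> ^ n * measure_pmf.expectation (state_law M \<pi> s n) W) \<longlonglongrightarrow> 0"
    by (intro summable_LIMSEQ_zero summable_discounted[of _ C] abs_expectation_le)
      (use set_state_law[OF s] W in auto)
  ultimately show ?thesis
    unfolding truncated_value_def[abs_def] using tendsto_add by fastforce
qed

text \<open>
  Playing one more step before the payout replaces the payout function \<open>W\<close> by its Bellman update,
  so the sign of \<open>bellman W - W\<close> decides whether the truncated values rise or fall.
\<close>

lemma truncated_value_Suc:
  assumes s: "s \<in> states M" and W: "\<And>t. t \<in> states M \<Longrightarrow> \<bar>W t\<bar> \<le> C"
  shows "truncated_value W s (Suc n) - truncated_value W s n =
    \<gamma> ^ n * (measure_pmf.expectation (state_law M \<pi> s n) (bellman \<gamma> M \<pi> W)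
      - measure_pmf.expectation (state_law M \<pi> s n) W)"
proof -
  let ?E = "\<lambda>h. measure_pmf.expectation (state_law M \<pi> s n) h"
  let ?next = "\<lambda>t. measure_pmf.expectation (step_pmf M \<pi> t) (\<lambda>x. W (snd (snd x)))"
  obtain B where B: "\<And>r. r \<in> rewards M \<Longrightarrow> \<bar>r\<bar> \<le> B"
    using rewards_bound[OF mdp] by metis
  have "?E (bellman \<gamma> M \<pi> W) = ?E (\<lambda>t. mean_reward M \<pi> t + \<gamma> * ?next t)"
    by (rule integral_cong_AE)
      (use set_state_law[OF s, of n] bellman_eq_expectation[of _ W C] W in
        \<open>auto simp: AE_measure_pmf_iff\<close>)
  also have "\<dots> = ?E (mean_reward M \<pi>) + \<gamma> * ?E ?next"
  proof -
    have visited: "t \<in> states M" if "t \<in> set_pmf (state_law M \<pi> s n)" for t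
      using set_state_law[OF s] that by auto
    have "integrable (state_law M \<pi> s n) (mean_reward M \<pi>)"
      by (rule integrable_pmf_bounded[where B = B], rule abs_mean_reward_le[OF visited B])
    moreover have "integrable (state_law M \<pi> s n) ?next"
      by (rule integrable_pmf_bounded[where B = C], rule abs_expectation_le,
        rule W, rule set_step_pmf(3)[OF visited])
    ultimately show ?thesis by simp
  qed
  also have "?E ?next = measure_pmf.expectation (state_law M \<pi> s (Suc n)) W"
  proof -
    have "measure_pmf.expectation (state_law M \<pi> s (Suc n)) W =
        ?E (\<lambda>t. measure_pmf.expectation (map_pmf (\<lambda>x. snd (snd x)) (step_pmf M \<pi> t)) W)"
      unfolding state_law.simps
    proof (rule expectation_bind_pmf)
      fix t y
      assume "t \<in> set_pmf (state_law M \<pi> s n)"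
        "y \<in> set_pmf (map_pmf (\<lambda>x. snd (snd x)) (step_pmf M \<pi> t))"
      then have "y \<in> states M"
        using set_state_law[OF s, of n] set_step_pmf(3)[of t] by fastforce
      then show "\<bar>W y\<bar> \<le> C" by (rule W)
    qed
    then show ?thesis by simp
  qed
  finally show ?thesis
    by (simp add: truncated_value_def algebra_simps)
qed

lemma expectation_state_law_mono:
  fixes h k :: "'s \<Rightarrow> real"
  assumes s: "s \<in> states M"
    and le: "\<And>t. t \<in> states M \<Longrightarrow> h t \<le> k t"
    and bd: "\<And>t. t \<in> states M \<Longrightarrow> \<bar>h t\<bar> \<le> C" "\<And>t. t \<in> states M \<Longrightarrow> \<bar>k t\<bar> \<le> C"
  shows "measure_pmf.expectation (state_law M \<pi> s n) h \<le> measure_pmf.expectation (state_law M \<pi> s n) k"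
  by (rule integral_mono_AE)
    (use set_state_law[OF s] in \<open>auto intro!: integrable_pmf_bounded[where B = C] bd le simp: AE_measure_pmf_iff\<close>)

lemma bellman_bounded:
  fixes W :: "'s \<Rightarrow> real"
  assumes W: "\<And>t. t \<in> states M \<Longrightarrow> \<bar>W t\<bar> \<le> C"
  obtains C' where "C \<le> C'" "\<And>t. t \<in> states M \<Longrightarrow> \<bar>bellman \<gamma> M \<pi> W t\<bar> \<le> C'"
proof -
  obtain B where B: "0 \<le> B" "\<And>r. r \<in> rewards M \<Longrightarrow> \<bar>r\<bar> \<le> B"
    using rewards_bound[OF mdp] by metis
  have "\<bar>bellman \<gamma> M \<pi> W t\<bar> \<le> B + \<bar>C\<bar>" if t: "t \<in> states M" for t
  proof -
    have "\<bar>\<gamma> * measure_pmf.expectation (step_pmf M \<pi> t) (\<lambda>x. W (snd (snd x)))\<bar> \<le> 1 * \<bar>C\<bar>"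
      unfolding abs_mult using discount_nonneg discount_less_1
      by (intro mult_mono abs_expectation_le order_trans[OF W abs_ge_self] set_step_pmf[OF t]) auto
    then show ?thesis
      using abs_mean_reward_le[OF t B(2)] bellman_eq_expectation[of t W C, OF t W] by linarith
  qed
  with B(1) show ?thesis by (intro that[of "B + \<bar>C\<bar>"]) auto
qed

lemma truncated_value_1:
  assumes s: "s \<in> states M" and W: "\<And>t. t \<in> states M \<Longrightarrow> \<bar>W t\<bar> \<le> C"
  shows "truncated_value W s 1 = bellman \<gamma> M \<pi> W s"
  using truncated_value_Suc[where n = 0, OF assms] by (simp add: truncated_value_def)

text \<open>
  If \<open>W\<close> does not exceed its Bellman update, the truncated values increase from \<open>W s\<close> at \<open>n = 0\<close>
  to the value of the policy in the limit. Stopping the comparison at \<open>n = 1\<close> rather than at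
  \<open>n = 0\<close> gives a sharper lower bound, and this is what makes policy improvement strict.
\<close>

lemma bellman_le_value_fun:
  assumes s: "s \<in> states M" and W: "\<And>t. t \<in> states M \<Longrightarrow> \<bar>W t\<bar> \<le> C"
    and sub: "\<And>t. t \<in> states M \<Longrightarrow> W t \<le> bellman \<gamma> M \<pi> W t"
  shows "bellman \<gamma> M \<pi> W s \<le> value_fun \<gamma> M \<pi> s"
proof -
  obtain C' where C': "C \<le> C'" "\<And>t. t \<in> states M \<Longrightarrow> \<bar>bellman \<gamma> M \<pi> W t\<bar> \<le> C'"
    using bellman_bounded[of W C] W by metis
  have "truncated_value W s n \<le> truncated_value W s (Suc n)" for n
  proof -
    have "measure_pmf.expectation (state_law M \<pi> s n) W \<le>
        measure_pmf.expectation (state_law M \<pi> s n) (bellman \<gamma> M \<pi> W)"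
      by (rule expectation_state_law_mono[OF s sub order_trans[OF W C'(1)] C'(2)])
    then have "0 \<le> truncated_value W s (Suc n) - truncated_value W s n"
      by (subst truncated_value_Suc[OF s W]) (use discount_nonneg in auto)
    then show ?thesis by simp
  qed
  then have "incseq (truncated_value W s)"
    by (rule incseq_SucI)
  from incseq_le[OF this truncated_value_tendsto[OF s W], of 1] show ?thesis
    by (simp only: truncated_value_1[OF s W])
qed

lemma value_fun_le_bellman:
  assumes s: "s \<in> states M" and W: "\<And>t. t \<in> states M \<Longrightarrow> \<bar>W t\<bar> \<le> C"
    and super: "\<And>t. t \<in> states M \<Longrightarrow> bellman \<gamma> M \<pi> W t \<le> W t"
  shows "value_fun \<gamma> M \<pi> s \<le> bellman \<gamma> M \<pi> W s"
proof -
  obtain C' where C': "C \<le> C'" "\<And>t. t \<in> states M \<Longrightarrow> \<bar>bellman \<gamma> M \<pi> W t\<bar> \<le> C'"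
    using bellman_bounded[of W C] W by metis
  have "truncated_value W s (Suc n) \<le> truncated_value W s n" for n
  proof -
    have "measure_pmf.expectation (state_law M \<pi> s n) (bellman \<gamma> M \<pi> W) \<le>
        measure_pmf.expectation (state_law M \<pi> s n) W"
      by (rule expectation_state_law_mono[OF s super C'(2) order_trans[OF W C'(1)]])
    then have "truncated_value W s (Suc n) - truncated_value W s n \<le> 0"
      by (subst truncated_value_Suc[OF s W]) (use discount_nonneg in \<open>auto intro: mult_nonneg_nonpos\<close>)
    then show ?thesis by simp
  qed
  then have "decseq (truncated_value W s)"
    by (rule decseq_SucI)
  from decseq_ge[OF this truncated_value_tendsto[OF s W], of 1] show ?thesis
    by (simp only: truncated_value_1[OF s W])
qed

text \<open>
  Splitting off the first reward leaves \<open>\<gamma>\<close> times a discounted sum that starts at time one; by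
  \<open>state_law_first_step\<close> its terms are averages, over the first step, of the terms from the new
  state. The average and the sum may be exchanged because of the geometric bound.
\<close>

lemma value_fun_bellman_fixpoint:
  assumes s: "s \<in> states M"
  shows "bellman \<gamma> M \<pi> (value_fun \<gamma> M \<pi>) s = value_fun \<gamma> M \<pi> s"
proof -
  obtain C where C: "\<And>t. t \<in> states M \<Longrightarrow> \<bar>value_fun \<gamma> M \<pi> t\<bar> \<le> C"
    using value_fun_bounded policy by metis
  obtain B where B: "0 \<le> B" "\<And>r. r \<in> rewards M \<Longrightarrow> \<bar>r\<bar> \<le> B"
    using rewards_bound[OF mdp] by metis
  define \<rho> where "\<rho> k t = measure_pmf.expectation (state_law M \<pi> t k) (mean_reward M \<pi>)" for k t
  let ?step = "step_pmf M \<pi> s"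
  have \<rho>_le: "\<bar>\<rho> k t\<bar> \<le> B" if "t \<in> states M" for k t
    unfolding \<rho>_def by (rule abs_mean_reward_law_le[OF that B(2)])
  have next_state: "snd (snd x) \<in> states M" if "x \<in> set_pmf ?step" for x
    by (rule set_step_pmf(3)[OF s that])
  have \<rho>_Suc: "\<rho> (Suc k) s = measure_pmf.expectation ?step (\<lambda>x. \<rho> k (snd (snd x)))" for k
    unfolding \<rho>_def state_law_first_step
    by (rule expectation_bind_pmf[where B = B])
      (use next_state set_state_law in \<open>blast intro: abs_mean_reward_le[OF _ B(2)]\<close>)
  have geo: "summable (\<lambda>k. \<gamma> ^ k * B)"
    using B(1) by (intro summable_discounted[of _ B]) simp
  have le: "\<bar>\<gamma> ^ k * \<rho> k (snd (snd x))\<bar> \<le> \<gamma> ^ k * B" if "x \<in> set_pmf ?step" for x k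
    using \<rho>_le[OF next_state[OF that]] discount_nonneg by (simp add: abs_mult mult_left_mono)
  have int: "integrable ?step (\<lambda>x. \<gamma> ^ k * \<rho> k (snd (snd x)))" for k
    by (rule integrable_pmf_bounded[OF le])
  have "value_fun \<gamma> M \<pi> s = (\<Sum>k. \<gamma> ^ k * \<rho> k s)"
    by (simp add: value_fun_eq_suminf[OF s] \<rho>_def)
  also have "\<dots> = \<rho> 0 s + (\<Sum>k. \<gamma> ^ Suc k * \<rho> (Suc k) s)"
    using suminf_split_head[OF summable_discounted[of "\<lambda>k. \<rho> k s" B]] \<rho>_le[OF s] by simp
  also have "(\<Sum>k. \<gamma> ^ Suc k * \<rho> (Suc k) s) = \<gamma> * (\<Sum>k. \<gamma> ^ k * \<rho> (Suc k) s)"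
  proof -
    have "\<bar>\<rho> (Suc k) s\<bar> \<le> B" for k
      by (rule \<rho>_le[OF s])
    from suminf_mult[OF summable_discounted[of "\<lambda>k. \<rho> (Suc k) s", OF this], of \<gamma>] show ?thesis
      by (simp add: mult.assoc)
  qed
  also have "(\<Sum>k. \<gamma> ^ k * \<rho> (Suc k) s) =
      (\<Sum>k. measure_pmf.expectation ?step (\<lambda>x. \<gamma> ^ k * \<rho> k (snd (snd x))))"
    by (simp add: \<rho>_Suc)
  also have "\<dots> = measure_pmf.expectation ?step (\<lambda>x. \<Sum>k. \<gamma> ^ k * \<rho> k (snd (snd x)))"
  proof (rule integral_suminf[OF int, symmetric])
    show "AE x in ?step. summable (\<lambda>k. norm (\<gamma> ^ k * \<rho> k (snd (snd x))))"
      by (rule AE_pmfI, rule summable_comparison_test[OF _ geo]) (use le in auto)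
    have "\<bar>measure_pmf.expectation ?step (\<lambda>x. \<bar>\<gamma> ^ k * \<rho> k (snd (snd x))\<bar>)\<bar> \<le> \<gamma> ^ k * B" for k
      by (rule abs_expectation_le) (use le in auto)
    then show "summable (\<lambda>k. measure_pmf.expectation ?step (\<lambda>x. norm (\<gamma> ^ k * \<rho> k (snd (snd x)))))"
      by (intro summable_comparison_test[OF _ geo]) auto
  qed
  also have "\<dots> = measure_pmf.expectation ?step (\<lambda>x. value_fun \<gamma> M \<pi> (snd (snd x)))"
    by (rule integral_cong_AE)
      (auto simp: AE_measure_pmf_iff \<rho>_def value_fun_eq_suminf[OF next_state])
  also have "\<rho> 0 s = mean_reward M \<pi> s"
    by (simp add: \<rho>_def)
  finally show ?thesis
    using bellman_eq_expectation[OF s C] by simp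
qed

end

section \<open>The Bellman characterization of optimal policies\<close>

lemma optimal_imp_discounted_policy:
  assumes "is_mdp M" "0 \<le> \<gamma>" "\<gamma> < 1" "\<pi> \<in> optimal_policies \<gamma> M"
  shows "discounted_policy M \<pi> \<gamma>"
  using assms by unfold_locales (auto simp: optimal_policies_def)

text \<open>
  A real supremum is an upper bound only of a set that is bounded above; the bound on the value
  functions that is uniform over all policies supplies this.
\<close>

lemma value_fun_le_optimal:
  assumes "is_mdp M" "0 \<le> \<gamma>" "\<gamma> < 1" "\<pi> \<in> optimal_policies \<gamma> M"
    and "\<sigma> \<in> policies M" "s \<in> states M"
  shows "value_fun \<gamma> M \<sigma> s \<le> value_fun \<gamma> M \<pi> s"
proof -
  interpret discounted_policy M \<pi> \<gamma>
    by (rule optimal_imp_discounted_policy) fact+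
  obtain C where C: "\<And>\<sigma> s. \<sigma> \<in> policies M \<Longrightarrow> s \<in> states M \<Longrightarrow> \<bar>value_fun \<gamma> M \<sigma> s\<bar> \<le> C"
    using value_fun_bounded by metis
  have "bdd_above ((\<lambda>\<sigma>. value_fun \<gamma> M \<sigma> s) ` policies M)"
    using C[OF _ assms(6)] by (intro bdd_aboveI[where M = C]) (auto simp: abs_le_iff)
  then have "value_fun \<gamma> M \<sigma> s \<le> opt_value \<gamma> M s"
    unfolding opt_value_def by (rule cSUP_upper[OF assms(5)])
  then show ?thesis
    using assms(4,6) by (simp add: optimal_policies_def)
qed

text \<open>
  Policy improvement: if some action \<open>a\<close> were better than \<open>\<pi>\<close> in the state \<open>s\<close>, the policy that
  takes \<open>a\<close> in \<open>s\<close> and follows \<open>\<pi>\<close> elsewhere would have a Bellman update of \<open>V\<^sub>\<pi>\<close> that nowhere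
  falls below \<open>V\<^sub>\<pi>\<close> and exceeds it in \<open>s\<close>. By \<open>bellman_le_value_fun\<close> its value in \<open>s\<close> would then
  be larger than the optimal one.
\<close>

lemma optimal_policy_action_value_le:
  assumes M: "is_mdp M" and \<gamma>: "0 \<le> \<gamma>" "\<gamma> < 1"
    and opt: "\<pi> \<in> optimal_policies \<gamma> M"
    and s: "s \<in> states M" and a: "a \<in> adm M s"
  shows "action_value \<gamma> M (value_fun \<gamma> M \<pi>) (s, a) \<le> value_fun \<gamma> M \<pi> s"
proof (rule ccontr)
  let ?V = "value_fun \<gamma> M \<pi>"
  assume "\<not> ?thesis"
  then have better: "?V s < action_value \<gamma> M ?V (s, a)"
    by simp
  interpret \<pi>: discounted_policy M \<pi> \<gamma>
    by (rule optimal_imp_discounted_policy) fact+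
  have fin: "finite (adm M t)" if "t \<in> states M" for t
    using M that by (auto simp: is_mdp_def)
  define \<sigma> where "\<sigma> = (\<lambda>(t, b)\<in>pairs M. if t = s then (if b = a then 1 else 0) else \<pi> (t, b))"
  have \<sigma>_s: "\<sigma> (s, b) = (if b = a then 1 else 0)" if "b \<in> adm M s" for b
    using s that by (simp add: \<sigma>_def mem_pairs_iff[OF M])
  have \<sigma>_other: "\<sigma> (t, b) = \<pi> (t, b)" if "t \<in> states M" "t \<noteq> s" "b \<in> adm M t" for t b
    using that by (simp add: \<sigma>_def mem_pairs_iff[OF M])
  have "(\<Sum>b\<in>adm M t. \<sigma> (t, b)) = 1" if t: "t \<in> states M" for t
  proof (cases "t = s")
    case True
    then show ?thesis using \<sigma>_s fin[OF s] a by (simp cong: sum.cong)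
  next
    case False
    then show ?thesis using \<sigma>_other[OF t] \<pi>.policy t by (simp add: policies_def cong: sum.cong)
  qed
  moreover have "\<sigma> \<in> pairs M \<rightarrow>\<^sub>E {0..1}"
    using \<pi>.policy by (auto simp: \<sigma>_def policies_def dest!: PiE_mem)
  ultimately have \<sigma>: "\<sigma> \<in> policies M"
    by (simp add: policies_def)
  interpret \<sigma>: discounted_policy M \<sigma> \<gamma>
    using M \<sigma> \<gamma> by unfold_locales
  have at_s: "bellman \<gamma> M \<sigma> ?V s = action_value \<gamma> M ?V (s, a)"
  proof -
    have "bellman \<gamma> M \<sigma> ?V s = (\<Sum>b\<in>adm M s. if b = a then action_value \<gamma> M ?V (s, b) else 0)"
      unfolding bellman_def by (intro sum.cong) (auto simp: \<sigma>_s)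
    then show ?thesis using fin[OF s] a by simp
  qed
  have sub: "?V t \<le> bellman \<gamma> M \<sigma> ?V t" if t: "t \<in> states M" for t
  proof (cases "t = s")
    case True
    then show ?thesis using better at_s by simp
  next
    case False
    then have "bellman \<gamma> M \<sigma> ?V t = bellman \<gamma> M \<pi> ?V t"
      unfolding bellman_def by (intro sum.cong) (simp_all add: \<sigma>_other[OF t])
    then show ?thesis using \<pi>.value_fun_bellman_fixpoint[OF t] by simp
  qed
  obtain C where "\<And>t. t \<in> states M \<Longrightarrow> \<bar>?V t\<bar> \<le> C"
    using \<pi>.value_fun_bounded \<pi>.policy by metis
  from \<sigma>.bellman_le_value_fun[OF s this sub]
  have "action_value \<gamma> M ?V (s, a) \<le> value_fun \<gamma> M \<sigma> s"
    by (simp add: at_s)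
  also have "\<dots> \<le> ?V s"
    by (rule value_fun_le_optimal[OF M \<gamma> opt \<sigma> s])
  finally show False using better by simp
qed

text \<open>
  Verification: a bounded \<open>W\<close> that no single action can beat dominates its Bellman update under
  every policy, hence dominates every value function. If in addition \<open>W\<close> is fixed by the Bellman
  operator of \<open>\<sigma>\<close>, then the value of \<open>\<sigma>\<close> is \<open>W\<close>, so \<open>\<sigma>\<close> attains the supremum.
\<close>

lemma optimal_policyI:
  assumes M: "is_mdp M" and \<gamma>: "0 \<le> \<gamma>" "\<gamma> < 1"
    and \<sigma>: "\<sigma> \<in> policies M"
    and bounded: "\<And>s. s \<in> states M \<Longrightarrow> \<bar>W s\<bar> \<le> C"
    and fixpoint: "\<And>s. s \<in> states M \<Longrightarrow> bellman \<gamma> M \<sigma> W s = W s"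
    and no_better: "\<And>s a. s \<in> states M \<Longrightarrow> a \<in> adm M s \<Longrightarrow> action_value \<gamma> M W (s, a) \<le> W s"
  shows "\<sigma> \<in> optimal_policies \<gamma> M"
proof -
  have upper: "value_fun \<gamma> M \<rho> s \<le> W s" if \<rho>: "\<rho> \<in> policies M" and s: "s \<in> states M" for \<rho> s
  proof -
    interpret \<rho>: discounted_policy M \<rho> \<gamma>
      using M \<rho> \<gamma> by unfold_locales
    have super: "bellman \<gamma> M \<rho> W t \<le> W t" if t: "t \<in> states M" for t
    proof -
      have "bellman \<gamma> M \<rho> W t \<le> (\<Sum>a\<in>adm M t. \<rho> (t, a) * W t)"
        unfolding bellman_def
        by (intro sum_mono mult_left_mono no_better \<rho>.policy_nonneg t)
      also have "\<dots> = W t"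
        using \<rho> t by (simp add: policies_def sum_distrib_right[symmetric])
      finally show ?thesis .
    qed
    show ?thesis
      using \<rho>.value_fun_le_bellman[of s W C, OF s bounded super] super[OF s] by simp
  qed
  interpret \<sigma>: discounted_policy M \<sigma> \<gamma>
    using M \<sigma> \<gamma> by unfold_locales
  have value_eq: "value_fun \<gamma> M \<sigma> s = W s" if s: "s \<in> states M" for s
    using \<sigma>.bellman_le_value_fun[of s W C, OF s bounded] fixpoint upper[OF \<sigma> s] s
    by (simp add: order_antisym)
  have "opt_value \<gamma> M s = W s" if s: "s \<in> states M" for s
    unfolding opt_value_def
  proof (rule cSup_eq_maximum)
    show "W s \<in> (\<lambda>\<rho>. value_fun \<gamma> M \<rho> s) ` policies M"
      by (rule image_eqI[where x = \<sigma>]) (use value_eq[OF s] \<sigma> in auto)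
  qed (use upper[OF _ s] in auto)
  then show ?thesis
    using \<sigma> value_eq by (simp add: optimal_policies_def)
qed

section \<open>Homomorphisms of Markov decision processes\<close>

text \<open>
  Relabelings and quotient maps are instances of one notion: actions are mapped onto the
  admissible actions of the image state, and the law of the outcome is transported. Surjectivity
  is asked only of the actions of each state, because optimality is a condition at each state and
  the trajectories that start in the image of \<open>f\<close> stay there.
\<close>

definition mdp_homomorphism ::
  "('s, 'a) mdp \<Rightarrow> ('t, 'b) mdp \<Rightarrow> ('s \<Rightarrow> 't) \<Rightarrow> ('s \<Rightarrow> 'a \<Rightarrow> 'b) \<Rightarrow> bool" where
  "mdp_homomorphism M N f g \<longleftrightarrow>
     f ` states M \<subseteq> states N \<and>
     (\<forall>s\<in>states M. g s ` adm M s = adm N (f s)) \<and>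
     (\<forall>s\<in>states M. \<forall>a\<in>adm M s.
        map_pmf (map_prod f id) (outcome_pmf M (s, a)) = outcome_pmf N (f s, g s a))"

text \<open>
  With \<open>V\<close> the value of \<open>\<pi>\<close>, the function \<open>V \<circ> f\<close> certifies the optimality of \<open>\<sigma>\<close> in the sense of
  \<open>optimal_policyI\<close>. Transport of the outcomes makes the action values with respect to \<open>V \<circ> f\<close>
  agree with those of \<open>N\<close>, so no action of \<open>M\<close> beats \<open>V \<circ> f\<close>; collecting the actions of \<open>M\<close> by
  their image and using that \<open>\<sigma>\<close> distributes the weight \<open>\<pi>(f s, c)\<close> over the fibre of \<open>c\<close>, the
  Bellman equation of \<open>V\<close> in \<open>N\<close> becomes that of \<open>V \<circ> f\<close> in \<open>M\<close>.
\<close>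

lemma optimal_policy_along_homomorphism:
  assumes M: "is_mdp M" and N: "is_mdp N" and \<gamma>: "0 \<le> \<gamma>" "\<gamma> < 1"
    and hom: "mdp_homomorphism M N f g"
    and opt: "\<pi> \<in> optimal_policies \<gamma> N"
    and \<sigma>: "\<sigma> \<in> policies M"
    and lift: "\<And>s c. s \<in> states M \<Longrightarrow> c \<in> adm N (f s) \<Longrightarrow>
      (\<Sum>a\<in>{a \<in> adm M s. g s a = c}. \<sigma> (s, a)) = \<pi> (f s, c)"
  shows "\<sigma> \<in> optimal_policies \<gamma> M"
proof -
  let ?V = "value_fun \<gamma> N \<pi>"
  let ?W = "\<lambda>s. ?V (f s)"
  interpret \<pi>: discounted_policy N \<pi> \<gamma>
    by (rule optimal_imp_discounted_policy) fact+
  have f: "f s \<in> states N" if "s \<in> states M" for s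
    using hom that by (auto simp: mdp_homomorphism_def)
  have g: "g s ` adm M s = adm N (f s)" if "s \<in> states M" for s
    using hom that by (auto simp: mdp_homomorphism_def)
  have q: "action_value \<gamma> M ?W (s, a) = action_value \<gamma> N ?V (f s, g s a)"
    if "s \<in> states M" "a \<in> adm M s" for s a
  proof -
    have "outcome_pmf N (f s, g s a) = map_pmf (map_prod f id) (outcome_pmf M (s, a))"
      using hom that by (simp add: mdp_homomorphism_def)
    then show ?thesis
      by (simp add: action_value_def case_prod_beta')
  qed
  obtain C where C: "\<And>t. t \<in> states N \<Longrightarrow> \<bar>?V t\<bar> \<le> C"
    using \<pi>.value_fun_bounded \<pi>.policy by metis
  show ?thesis
  proof (rule optimal_policyI[OF M \<gamma> \<sigma>])
    fix s assume s: "s \<in> states M"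
    show "\<bar>?W s\<bar> \<le> C"
      by (rule C[OF f[OF s]])
    have fin: "finite (adm M s)"
      using M s by (auto simp: is_mdp_def)
    have "bellman \<gamma> M \<sigma> ?W s = (\<Sum>a\<in>adm M s. \<sigma> (s, a) * action_value \<gamma> N ?V (f s, g s a))"
      unfolding bellman_def by (intro sum.cong) (simp_all add: q[OF s])
    also have "\<dots> = (\<Sum>c\<in>g s ` adm M s. \<Sum>a\<in>{a \<in> adm M s. g s a = c}.
        \<sigma> (s, a) * action_value \<gamma> N ?V (f s, g s a))"
      by (rule sum.image_gen[OF fin])
    also have "\<dots> = (\<Sum>c\<in>adm N (f s). (\<Sum>a\<in>{a \<in> adm M s. g s a = c}. \<sigma> (s, a)) *
        action_value \<gamma> N ?V (f s, c))"
      unfolding g[OF s] sum_distrib_right by (intro sum.cong) auto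
    also have "\<dots> = bellman \<gamma> N \<pi> ?V (f s)"
      unfolding bellman_def by (intro sum.cong) (simp_all add: lift[OF s])
    also have "\<dots> = ?W s"
      by (rule \<pi>.value_fun_bellman_fixpoint[OF f[OF s]])
    finally show "bellman \<gamma> M \<sigma> ?W s = ?W s" .
    fix a assume a: "a \<in> adm M s"
    then have "g s a \<in> adm N (f s)"
      using g[OF s] by auto
    then show "action_value \<gamma> M ?W (s, a) \<le> ?W s"
      unfolding q[OF s a] by (rule optimal_policy_action_value_le[OF N \<gamma> opt f[OF s]])
  qed
qed

section \<open>Relabelings\<close>

definition relabeled_policy ::
  "('s, 'a) mdp \<Rightarrow> ('s \<Rightarrow> 't) \<Rightarrow> ('s \<Rightarrow> 'a \<Rightarrow> 'b) \<Rightarrow> ('t \<times> 'b \<Rightarrow> real) \<Rightarrow> 's \<times> 'a \<Rightarrow> real" where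
  "relabeled_policy M f g \<rho> = (\<lambda>(s, a)\<in>pairs M. \<rho> (f s, g s a))"

lemma relabeled_policy_in_policies:
  assumes M: "is_mdp M" and N: "is_mdp N"
    and f: "\<And>s. s \<in> states M \<Longrightarrow> f s \<in> states N"
    and g: "\<And>s. s \<in> states M \<Longrightarrow> bij_betw (g s) (adm M s) (adm N (f s))"
    and \<rho>: "\<rho> \<in> policies N"
  shows "relabeled_policy M f g \<rho> \<in> policies M"
proof -
  have "(\<Sum>a\<in>adm M s. relabeled_policy M f g \<rho> (s, a)) = 1" if s: "s \<in> states M" for s
  proof -
    have "(\<Sum>a\<in>adm M s. relabeled_policy M f g \<rho> (s, a)) = (\<Sum>a\<in>adm M s. \<rho> (f s, g s a))"
      using s by (intro sum.cong) (simp_all add: relabeled_policy_def mem_pairs_iff[OF M])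
    also have "\<dots> = (\<Sum>b\<in>adm N (f s). \<rho> (f s, b))"
      by (rule sum.reindex_bij_betw[OF g[OF s]])
    also have "\<dots> = 1"
      using \<rho> f[OF s] by (simp add: policies_def)
    finally show ?thesis .
  qed
  moreover have "relabeled_policy M f g \<rho> x \<in> {0..1}" if x: "x \<in> pairs M" for x
  proof -
    obtain s a where "x = (s, a)" "s \<in> states M" "a \<in> adm M s"
      using x by (cases x) (auto simp: mem_pairs_iff[OF M])
    moreover from this have "(f s, g s a) \<in> pairs N"
      using f g by (auto simp: mem_pairs_iff[OF N] bij_betw_def)
    moreover have "\<rho> \<in> pairs N \<rightarrow>\<^sub>E {0..1}"
      using \<rho> by (simp add: policies_def)
    ultimately show ?thesis
      using x by (auto simp: relabeled_policy_def dest!: PiE_mem)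
  qed
  ultimately show ?thesis
    by (auto simp: policies_def relabeled_policy_def)
qed

lemma pmf_map_bij_betw:
  assumes bij: "bij_betw h A B" and p: "set_pmf p \<subseteq> A" and q: "set_pmf q \<subseteq> B"
    and eq: "\<And>x. x \<in> A \<Longrightarrow> pmf p x = pmf q (h x)"
  shows "map_pmf h p = q"
proof (rule pmf_eqI)
  fix y
  have inj: "inj_on h (set_pmf p)"
    using bij p by (auto simp: bij_betw_def intro: inj_on_subset)
  show "pmf (map_pmf h p) y = pmf q y"
  proof (cases "y \<in> h ` set_pmf p")
    case True
    then show ?thesis using p by (auto simp: pmf_map_inj[OF inj] eq)
  next
    case False
    have "y \<notin> set_pmf q"
    proof
      assume y: "y \<in> set_pmf q"
      then obtain x where "x \<in> A" "y = h x"
        using bij q by (auto simp: bij_betw_def)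
      with y False show False
        using eq[of x] by (auto simp: set_pmf_iff)
    qed
    then show ?thesis using False by (simp add: pmf_map_outside set_pmf_iff)
  qed
qed

lemma relabeling_imp_homomorphism:
  assumes M: "is_mdp M" and N: "is_mdp N" and rel: "relabeling M N f g"
  shows "mdp_homomorphism M N f g"
proof -
  have f: "bij_betw f (states M) (states N)"
    and g: "\<And>s. s \<in> states M \<Longrightarrow> bij_betw (g s) (adm M s) (adm N (f s))"
    and R: "rewards M = rewards N"
    using rel by (auto simp: relabeling_def)
  have "map_pmf (map_prod f id) (outcome_pmf M (s, a)) = outcome_pmf N (f s, g s a)"
    if s: "s \<in> states M" and a: "a \<in> adm M s" for s a
  proof (rule pmf_map_bij_betw)
    have sa: "(s, a) \<in> pairs M"
      using s a by (simp add: mem_pairs_iff[OF M])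
    have "f s \<in> states N" "g s a \<in> adm N (f s)"
      using f g[OF s] s a by (auto simp: bij_betw_def)
    then have fg: "(f s, g s a) \<in> pairs N"
      by (simp add: mem_pairs_iff[OF N])
    show "bij_betw (map_prod f id) (states M \<times> rewards M) (states N \<times> rewards N)"
      using f R by (auto intro: bij_betw_map_prod)
    show "set_pmf (outcome_pmf M (s, a)) \<subseteq> states M \<times> rewards M"
      by (rule set_outcome_pmf[OF M sa])
    show "set_pmf (outcome_pmf N (f s, g s a)) \<subseteq> states N \<times> rewards N"
      by (rule set_outcome_pmf[OF N fg])
    fix x assume "x \<in> states M \<times> rewards M"
    then show "pmf (outcome_pmf M (s, a)) x = pmf (outcome_pmf N (f s, g s a)) (map_prod f id x)"
      using rel sa f R by (auto simp: pmf_outcome_pmf[OF M sa] pmf_outcome_pmf[OF N fg]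
          relabeling_def bij_betw_def)
  qed
  then show ?thesis
    using f g by (auto simp: mdp_homomorphism_def bij_betw_def)
qed

lemma relabeled_policy_optimal:
  assumes M: "is_mdp M" and N: "is_mdp N" and \<gamma>: "0 \<le> \<gamma>" "\<gamma> < 1"
    and rel: "relabeling M N f g"
    and opt: "\<rho> \<in> optimal_policies \<gamma> N"
  shows "relabeled_policy M f g \<rho> \<in> optimal_policies \<gamma> M"
proof (rule optimal_policy_along_homomorphism[OF M N \<gamma> _ opt])
  show "mdp_homomorphism M N f g"
    by (rule relabeling_imp_homomorphism) fact+
  have f: "\<And>s. s \<in> states M \<Longrightarrow> f s \<in> states N"
    and g: "\<And>s. s \<in> states M \<Longrightarrow> bij_betw (g s) (adm M s) (adm N (f s))"
    using rel by (auto simp: relabeling_def bij_betw_def)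
  show "relabeled_policy M f g \<rho> \<in> policies M"
    by (rule relabeled_policy_in_policies[OF M N f g]) (use opt in \<open>auto simp: optimal_policies_def\<close>)
  fix s c assume s: "s \<in> states M" and c: "c \<in> adm N (f s)"
  then obtain a where a: "a \<in> adm M s" "c = g s a"
    using g[OF s] by (auto simp: bij_betw_def)
  then have "{a' \<in> adm M s. g s a' = c} = {a}"
    using g[OF s] by (auto simp: bij_betw_def inj_on_def)
  then show "(\<Sum>a\<in>{a \<in> adm M s. g s a = c}. relabeled_policy M f g \<rho> (s, a)) = \<rho> (f s, c)"
    using a s by (simp add: relabeled_policy_def mem_pairs_iff[OF M])
qed

section \<open>The quotient by a visible symmetry\<close>

lemma quotient_mdp_simps [simp]:
  "states (quotient_mdp M ES EP) = states M // ES"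
  "actions (quotient_mdp M ES EP) = pairs M // EP"
  "pairs (quotient_mdp M ES EP) = {(ES `` {s}, EP `` {(s, a)}) | s a. (s, a) \<in> pairs M}"
  "rewards (quotient_mdp M ES EP) = rewards M"
  by (simp_all add: quotient_mdp_def)

text \<open>
  A class of pairs is admissible in \<open>[s]\<close> as soon as it contains a pair over some \<open>t\<close> equivalent
  to \<open>s\<close>; condition (i) of a visible symmetry moves that pair to one over \<open>s\<close> itself. So every
  action of the quotient is represented at every representative of the state.
\<close>

lemma quotient_adm:
  assumes M: "is_mdp M" and sym: "visible_symmetry M ES EP" and s: "s \<in> states M"
  shows "adm (quotient_mdp M ES EP) (ES `` {s}) = (\<lambda>a. EP `` {(s, a)}) ` adm M s"
proof
  have eS: "equiv (states M) ES" and eP: "equiv (pairs M) EP"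
    using sym by (auto simp: visible_symmetry_def)
  show "(\<lambda>a. EP `` {(s, a)}) ` adm M s \<subseteq> adm (quotient_mdp M ES EP) (ES `` {s})"
  proof
    fix c assume "c \<in> (\<lambda>a. EP `` {(s, a)}) ` adm M s"
    then obtain a where "(s, a) \<in> pairs M" "c = EP `` {(s, a)}"
      using s by (auto simp: mem_pairs_iff[OF M])
    then show "c \<in> adm (quotient_mdp M ES EP) (ES `` {s})"
      by (auto simp: adm_def intro: quotientI)
  qed
  show "adm (quotient_mdp M ES EP) (ES `` {s}) \<subseteq> (\<lambda>a. EP `` {(s, a)}) ` adm M s"
  proof
    fix c assume "c \<in> adm (quotient_mdp M ES EP) (ES `` {s})"
    then obtain t b where tb: "(t, b) \<in> pairs M" and cls: "ES `` {s} = ES `` {t}"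
      and c: "c = EP `` {(t, b)}"
      by (auto simp: adm_def)
    have "(t, s) \<in> ES"
      using eq_equiv_class[OF cls eS] tb s eS by (auto simp: mem_pairs_iff[OF M] equiv_def sym_def)
    then obtain a where a: "a \<in> adm M s" and "((t, b), (s, a)) \<in> EP"
      using sym tb s unfolding visible_symmetry_def by blast
    then show "c \<in> (\<lambda>a. EP `` {(s, a)}) ` adm M s"
      using equiv_class_eq[OF eP] c by auto
  qed
qed

text \<open>
  The aggregated probability of a class of states is the probability mass of the image of the
  outcome under the class map. Hence summability and total mass of the quotient dynamic come from
  the image being a probability mass function.
\<close>

lemma pmf_class_outcome:
  assumes M: "is_mdp M" and sym: "visible_symmetry M ES EP" and x: "x \<in> pairs M"
  shows "pmf (map_pmf (map_prod (\<lambda>s. ES `` {s}) id) (outcome_pmf M x)) (X, r) =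
    (if X \<in> states M // ES \<and> r \<in> rewards M then set_prob M X r x else 0)"
proof (cases "X \<in> states M // ES \<and> r \<in> rewards M")
  case True
  have eS: "equiv (states M) ES"
    using sym by (simp add: visible_symmetry_def)
  have X: "X \<subseteq> states M"
    using True Union_quotient[OF eS] by auto
  have mem: "ES `` {t} = X \<longleftrightarrow> t \<in> X" if "t \<in> states M" for t
    using True that eS
    by (metis Image_singleton_iff equiv_class_eq_iff equiv_class_self quotientE)
  have "pmf (map_pmf (map_prod (\<lambda>s. ES `` {s}) id) (outcome_pmf M x)) (X, r) =
      measure_pmf.prob (outcome_pmf M x) (map_prod (\<lambda>s. ES `` {s}) id -` {(X, r)})"
    by (rule pmf_map)
  also have "\<dots> = measure_pmf.prob (outcome_pmf M x) (X \<times> {r})"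
    by (rule measure_eq_AE)
      (use set_outcome_pmf[OF M x] mem in \<open>auto simp: AE_measure_pmf_iff\<close>)
  also have "\<dots> = infsetsum (pmf (outcome_pmf M x)) (X \<times> {r})"
    by (rule measure_pmf_conv_infsetsum)
  also have "\<dots> = infsum (pmf (outcome_pmf M x)) (X \<times> {r})"
    by (rule infsetsum_infsum[OF pmf_abs_summable])
  also have "X \<times> {r} = (\<lambda>s'. (s', r)) ` X"
    by auto
  also have "infsum (pmf (outcome_pmf M x)) ((\<lambda>s'. (s', r)) ` X) =
      infsum (pmf (outcome_pmf M x) \<circ> (\<lambda>s'. (s', r))) X"
    by (rule infsum_reindex) (simp add: inj_on_def)
  also have "\<dots> = set_prob M X r x"
    unfolding set_prob_def
    by (rule infsum_cong) (use X True in \<open>auto simp: pmf_outcome_pmf[OF M x]\<close>)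
  finally show ?thesis
    unfolding if_P[OF True] .
next
  case False
  have "(X, r) \<notin> set_pmf (map_pmf (map_prod (\<lambda>s. ES `` {s}) id) (outcome_pmf M x))"
    using False set_outcome_pmf[OF M x] by (auto intro: quotientI)
  then show ?thesis
    using False by (simp only: set_pmf_iff) auto
qed

text \<open>
  The quotient dynamic is evaluated at a chosen representative; condition (ii) of a visible
  symmetry makes the choice irrelevant.
\<close>

lemma quotient_dyn:
  assumes sym: "visible_symmetry M ES EP" and x: "(s, a) \<in> pairs M"
    and X: "X \<in> states M // ES" and r: "r \<in> rewards M"
  shows "dyn (quotient_mdp M ES EP) X r (Y, EP `` {(s, a)}) = set_prob M X r (s, a)"
proof -
  have "equiv (pairs M) EP"
    using sym by (simp add: visible_symmetry_def)
  then have "\<exists>y. y \<in> EP `` {(s, a)}"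
    using x by (meson equiv_class_self)
  then have "(SOME y. y \<in> EP `` {(s, a)}) \<in> EP `` {(s, a)}"
    by (rule someI_ex)
  then obtain t b where "(SOME y. y \<in> EP `` {(s, a)}) = (t, b)" "((s, a), (t, b)) \<in> EP"
    by (metis Image_singleton_iff surj_pair)
  then show ?thesis
    using sym X r by (auto simp: quotient_mdp_def visible_symmetry_def)
qed

lemma is_mdp_quotient:
  assumes M: "is_mdp M" and sym: "visible_symmetry M ES EP"
  shows "is_mdp (quotient_mdp M ES EP)"
proof -
  let ?Q = "quotient_mdp M ES EP"
  have "countable (states ?Q)"
    using M by (simp add: is_mdp_def quotient_def)
  moreover have "pairs ?Q \<subseteq> states ?Q \<times> actions ?Q"
    by (auto simp: mem_pairs_iff[OF M] intro: quotientI)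
  moreover have "adm ?Q Y \<noteq> {} \<and> finite (adm ?Q Y)" if Y: "Y \<in> states ?Q" for Y
  proof -
    obtain s where "s \<in> states M" "Y = ES `` {s}"
      using Y by (auto simp: quotient_def)
    then show ?thesis
      using M by (simp add: quotient_adm[OF M sym] is_mdp_def)
  qed
  moreover have "bounded (rewards ?Q)"
    using M by (simp add: is_mdp_def)
  moreover have "(\<forall>X\<in>states ?Q. \<forall>r\<in>rewards ?Q. dyn ?Q X r y \<in> {0..1}) \<and>
      ((\<lambda>(X, r). dyn ?Q X r y) has_sum 1) (states ?Q \<times> rewards ?Q)" if y: "y \<in> pairs ?Q" for y
  proof -
    obtain s a where sa: "(s, a) \<in> pairs M" and y: "y = (ES `` {s}, EP `` {(s, a)})"
      using y by auto
    let ?p = "map_pmf (map_prod (\<lambda>s. ES `` {s}) id) (outcome_pmf M (s, a))"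
    let ?A = "states ?Q \<times> rewards ?Q"
    have dyn: "dyn ?Q X r y = pmf ?p (X, r)" if "X \<in> states ?Q" "r \<in> rewards ?Q" for X r
      using that by (simp add: y pmf_class_outcome[OF M sym sa] quotient_dyn[OF sym sa])
    have "set_pmf ?p \<subseteq> ?A"
      using set_outcome_pmf[OF M sa] by (auto intro: quotientI)
    then have "infsetsum (pmf ?p) ?A = 1"
      by (rule infsetsum_pmf_eq_1)
    then have "infsum (pmf ?p) ?A = 1"
      by (simp add: infsetsum_infsum[OF pmf_abs_summable])
    moreover have "pmf ?p summable_on ?A"
      by (rule iffD2[OF summable_on_iff_abs_summable_on_real,
          OF iffD2[OF abs_summable_equivalent, OF pmf_abs_summable]])
    ultimately have "(pmf ?p has_sum 1) ?A"
      by (metis has_sum_infsum)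
    moreover have "((\<lambda>(X, r). dyn ?Q X r y) has_sum 1) ?A \<longleftrightarrow> (pmf ?p has_sum 1) ?A"
      by (rule has_sum_cong) (auto simp: dyn)
    ultimately show ?thesis
      by (auto simp: dyn pmf_le_1)
  qed
  ultimately show ?thesis
    unfolding is_mdp_def by blast
qed

text \<open>
  The pullback along the quotient map alone: a pair class carries the weight given by \<open>\<pi>\<close>, shared
  equally by the actions of the state that belong to it.
\<close>

definition quotient_lift ::
  "('s, 'a) mdp \<Rightarrow> ('s \<times> 's) set \<Rightarrow> (('s \<times> 'a) \<times> ('s \<times> 'a)) set
     \<Rightarrow> ('s set \<times> ('s \<times> 'a) set \<Rightarrow> real) \<Rightarrow> 's \<times> 'a \<Rightarrow> real" where
  "quotient_lift M ES EP \<pi> =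
     (\<lambda>(s, a)\<in>pairs M. \<pi> (ES `` {s}, EP `` {(s, a)}) / real (N_pairs M EP s a))"

lemma sum_quotient_lift_fibre:
  assumes M: "is_mdp M" and sym: "visible_symmetry M ES EP" and s: "s \<in> states M"
    and c: "c \<in> adm (quotient_mdp M ES EP) (ES `` {s})"
  shows "(\<Sum>a\<in>{a \<in> adm M s. EP `` {(s, a)} = c}. quotient_lift M ES EP \<pi> (s, a)) = \<pi> (ES `` {s}, c)"
proof -
  let ?F = "{a \<in> adm M s. EP `` {(s, a)} = c}"
  have eP: "equiv (pairs M) EP"
    using sym by (simp add: visible_symmetry_def)
  have fin: "finite ?F"
    using M s by (auto simp: is_mdp_def)
  have "?F \<noteq> {}"
    using c by (auto simp: quotient_adm[OF M sym s])
  have N: "N_pairs M EP s a = card ?F" if "a \<in> ?F" for a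
  proof -
    have "((s, a), (s, a')) \<in> EP \<longleftrightarrow> EP `` {(s, a')} = c" if "a' \<in> adm M s" for a'
      using that \<open>a \<in> ?F\<close> s eq_equiv_class_iff[OF eP, of "(s, a)" "(s, a')"]
      by (simp add: mem_pairs_iff[OF M] eq_commute)
    then have "{a' \<in> adm M s. ((s, a), (s, a')) \<in> EP} = ?F"
      by blast
    then show ?thesis by (simp add: N_pairs_def)
  qed
  have "(\<Sum>a\<in>?F. quotient_lift M ES EP \<pi> (s, a)) = (\<Sum>a\<in>?F. \<pi> (ES `` {s}, c) / real (card ?F))"
    using s N by (intro sum.cong) (auto simp: quotient_lift_def mem_pairs_iff[OF M])
  also have "\<dots> = \<pi> (ES `` {s}, c)"
    using fin \<open>?F \<noteq> {}\<close> by simp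
  finally show ?thesis .
qed

lemma N_pairs_pos:
  assumes M: "is_mdp M" and sym: "visible_symmetry M ES EP" and x: "(s, a) \<in> pairs M"
  shows "1 \<le> N_pairs M EP s a"
proof -
  have "((s, a), (s, a)) \<in> EP"
    using sym x by (auto simp: visible_symmetry_def equiv_def refl_on_def)
  then have "a \<in> {a' \<in> adm M s. ((s, a), (s, a')) \<in> EP}"
    using x by (simp add: mem_pairs_iff[OF M])
  moreover have "finite (adm M s)"
    using M x by (auto simp: is_mdp_def)
  ultimately have "0 < N_pairs M EP s a"
    unfolding N_pairs_def by (subst card_gt_0_iff) auto
  then show ?thesis by simp
qed

lemma quotient_lift_in_policies:
  assumes M: "is_mdp M" and sym: "visible_symmetry M ES EP"
    and \<pi>: "\<pi> \<in> policies (quotient_mdp M ES EP)"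
  shows "quotient_lift M ES EP \<pi> \<in> policies M"
proof -
  let ?Q = "quotient_mdp M ES EP"
  have "(\<Sum>a\<in>adm M s. quotient_lift M ES EP \<pi> (s, a)) = 1" if s: "s \<in> states M" for s
  proof -
    have "finite (adm M s)"
      using M s by (auto simp: is_mdp_def)
    then have "(\<Sum>a\<in>adm M s. quotient_lift M ES EP \<pi> (s, a)) =
        (\<Sum>c\<in>adm ?Q (ES `` {s}). \<Sum>a\<in>{a \<in> adm M s. EP `` {(s, a)} = c}. quotient_lift M ES EP \<pi> (s, a))"
      unfolding quotient_adm[OF M sym s] by (rule sum.image_gen)
    also have "\<dots> = (\<Sum>c\<in>adm ?Q (ES `` {s}). \<pi> (ES `` {s}, c))"
      by (intro sum.cong refl sum_quotient_lift_fibre[OF M sym s])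
    also have "\<dots> = 1"
      using \<pi> s by (simp add: policies_def quotientI)
    finally show ?thesis .
  qed
  moreover have "quotient_lift M ES EP \<pi> x \<in> {0..1}" if x: "x \<in> pairs M" for x
  proof -
    obtain s a where sa: "x = (s, a)"
      by (cases x)
    have "(ES `` {s}, EP `` {(s, a)}) \<in> pairs ?Q"
      using x sa by auto
    moreover have "\<pi> \<in> pairs ?Q \<rightarrow>\<^sub>E {0..1}"
      using \<pi> by (simp add: policies_def)
    ultimately have "\<pi> (ES `` {s}, EP `` {(s, a)}) \<in> {0..1}"
      by (rule PiE_mem[rotated])
    moreover have "1 \<le> real (N_pairs M EP s a)"
      using N_pairs_pos[OF M sym] x sa by fastforce
    ultimately show ?thesis
      using x by (auto simp: sa quotient_lift_def divide_le_eq_1)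
  qed
  ultimately show ?thesis
    by (auto simp: policies_def quotient_lift_def)
qed

lemma quotient_homomorphism:
  assumes M: "is_mdp M" and sym: "visible_symmetry M ES EP"
  shows "mdp_homomorphism M (quotient_mdp M ES EP) (\<lambda>s. ES `` {s}) (\<lambda>s a. EP `` {(s, a)})"
proof -
  let ?Q = "quotient_mdp M ES EP"
  have "map_pmf (map_prod (\<lambda>s. ES `` {s}) id) (outcome_pmf M (s, a)) =
      outcome_pmf ?Q (ES `` {s}, EP `` {(s, a)})" if s: "s \<in> states M" and a: "a \<in> adm M s" for s a
  proof (rule pmf_eqI)
    fix y :: "'a set \<times> real"
    have sa: "(s, a) \<in> pairs M"
      using s a by (simp add: mem_pairs_iff[OF M])
    then have cls: "(ES `` {s}, EP `` {(s, a)}) \<in> pairs ?Q"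
      by auto
    obtain X r where y: "y = (X, r)"
      by (cases y)
    show "pmf (map_pmf (map_prod (\<lambda>s. ES `` {s}) id) (outcome_pmf M (s, a))) y =
        pmf (outcome_pmf ?Q (ES `` {s}, EP `` {(s, a)})) y"
      unfolding y pmf_class_outcome[OF M sym sa] pmf_outcome_pmf[OF is_mdp_quotient[OF M sym] cls]
      using quotient_dyn[OF sym sa] by simp
  qed
  then show ?thesis
    by (auto simp: mdp_homomorphism_def quotient_adm[OF M sym] intro: quotientI)
qed

lemma quotient_lift_optimal:
  assumes M: "is_mdp M" and \<gamma>: "0 \<le> \<gamma>" "\<gamma> < 1" and sym: "visible_symmetry M ES EP"
    and opt: "\<pi> \<in> optimal_policies \<gamma> (quotient_mdp M ES EP)"
  shows "quotient_lift M ES EP \<pi> \<in> optimal_policies \<gamma> M"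
proof (rule optimal_policy_along_homomorphism[OF M is_mdp_quotient[OF M sym] \<gamma>
      quotient_homomorphism[OF M sym] opt])
  show "quotient_lift M ES EP \<pi> \<in> policies M"
    by (rule quotient_lift_in_policies[OF M sym]) (use opt in \<open>simp add: optimal_policies_def\<close>)
qed (rule sum_quotient_lift_fibre[OF M sym])

lemma N_pairs_simple:
  assumes "is_mdp M" "visible_symmetry M ES EP" "simple_symmetry EP" "(s, a) \<in> pairs M"
  shows "N_pairs M EP s a = 1"
proof -
  have "((s, a), (s, a)) \<in> EP"
    using assms by (auto simp: visible_symmetry_def equiv_def refl_on_def)
  then have "{a' \<in> adm M s. ((s, a), (s, a')) \<in> EP} = {a}"
    using assms by (auto simp: mem_pairs_iff simple_symmetry_def)
  then show ?thesis by (simp add: N_pairs_def)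
qed

section \<open>Equivalent processes and the pullback\<close>

lemma same_transition_structure_sets:
  assumes "same_transition_structure M N"
  shows "states M = states N" "pairs M = pairs N" "adm M s = adm N s"
  using assms by (auto simp: same_transition_structure_def adm_def)

text \<open>
  Each of the four kinds of equivalence changes at most the dynamic and the rewards besides
  renaming, so on the level of states and admissible actions only the renaming is visible.
\<close>

lemma equivalence_relabeling_bijections:
  assumes "equivalence_relabeling \<gamma> M M' f g" and s: "s \<in> states M"
  shows "f s \<in> states M'" "bij_betw (g s) (adm M s) (adm M' (f s))"
proof -
  have rel: "f s \<in> states N \<and> bij_betw (g s) (adm L s) (adm N (f s))"
    if "relabeling L N f g" "s \<in> states L" for L N
    using that by (auto simp: relabeling_def bij_betw_def)
  have triv: "bij_betw (g s) (adm M s) (adm M s)" if "\<forall>a\<in>adm M s. g s a = a"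
    using that by (auto simp: bij_betw_def inj_on_def)
  have same: "states L = states N \<and> (\<forall>t. adm L t = adm N t)" if "same_trans_opt \<gamma> L N" for L N :: "('a, 'b) mdp"
    using that same_transition_structure_sets[of L N] by (simp add: same_trans_opt_def)
  have "f s \<in> states M' \<and> bij_betw (g s) (adm M s) (adm M' (f s))"
    using assms(1) unfolding equivalence_relabeling_def
  proof (elim disjE exE conjE)
    assume "relabeling M M' f g"
    then show ?thesis using rel s by blast
  next
    assume "same_trans_opt \<gamma> M M'" "\<forall>s\<in>states M. f s = s \<and> (\<forall>a\<in>adm M s. g s a = a)"
    then show ?thesis using same triv s by metis
  next
    fix Mt assume "relabeling M Mt f g" "same_trans_opt \<gamma> Mt M'"
    then show ?thesis using rel same s by metis
  next
    fix Mt assume "same_trans_opt \<gamma> M Mt" "relabeling Mt M' f g"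
    then show ?thesis using rel same s by metis
  qed
  then show "f s \<in> states M'" "bij_betw (g s) (adm M s) (adm M' (f s))" by auto
qed

text \<open>
  An equivalence is a renaming, preceded or followed by a change of rewards and dynamic that keeps
  the set of optimal policies; the renaming transports optimality by itself.
\<close>

lemma relabeled_policy_optimal_equivalent:
  assumes M: "is_mdp M" and M': "is_mdp M'" and \<gamma>: "0 \<le> \<gamma>" "\<gamma> < 1"
    and rel: "equivalence_relabeling \<gamma> M M' f g"
    and opt: "\<rho> \<in> optimal_policies \<gamma> M'"
  shows "relabeled_policy M f g \<rho> \<in> optimal_policies \<gamma> M"
  using rel unfolding equivalence_relabeling_def
proof (elim disjE exE conjE)
  assume "relabeling M M' f g"
  then show ?thesis
    by (rule relabeled_policy_optimal[OF M M' \<gamma> _ opt])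
next
  assume same: "same_trans_opt \<gamma> M M'"
    and triv: "\<forall>s\<in>states M. f s = s \<and> (\<forall>a\<in>adm M s. g s a = a)"
  have \<rho>: "\<rho> \<in> optimal_policies \<gamma> M"
    using same opt by (simp add: same_trans_opt_def)
  then have ext: "\<rho> \<in> pairs M \<rightarrow>\<^sub>E {0..1}"
    by (simp add: optimal_policies_def policies_def)
  have "relabeled_policy M f g \<rho> = \<rho>"
  proof
    fix x
    show "relabeled_policy M f g \<rho> x = \<rho> x"
      using triv PiE_arb[OF ext, of x] by (cases x) (auto simp: relabeled_policy_def mem_pairs_iff[OF M])
  qed
  then show ?thesis using \<rho> by simp
next
  fix Mt assume Mt: "is_mdp Mt" and "relabeling M Mt f g" and same: "same_trans_opt \<gamma> Mt M'"
  moreover have "\<rho> \<in> optimal_policies \<gamma> Mt"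
    using same opt by (simp add: same_trans_opt_def)
  ultimately show ?thesis
    by (intro relabeled_policy_optimal[OF M Mt \<gamma>])
next
  fix Mt assume Mt: "is_mdp Mt" and same: "same_trans_opt \<gamma> M Mt" and "relabeling Mt M' f g"
  then have "relabeled_policy Mt f g \<rho> \<in> optimal_policies \<gamma> Mt"
    by (intro relabeled_policy_optimal[OF Mt M' \<gamma> _ opt])
  then show ?thesis
    using same by (simp add: same_trans_opt_def same_transition_structure_def relabeled_policy_def)
qed

theorem theorem3p4:
  fixes M M' :: "('s, 'a) mdp" and \<gamma> :: real
    and ES :: "('s \<times> 's) set" and EP :: "(('s \<times> 'a) \<times> ('s \<times> 'a)) set"
    and f :: "'s \<Rightarrow> 's" and g :: "'s \<Rightarrow> 'a \<Rightarrow> 'a"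
  assumes "0 \<le> \<gamma>" and "\<gamma> < 1"
    and "is_mdp M" and "is_mdp M'"
    and "hidden_symmetry \<gamma> M M' ES EP"
    and "equivalence_relabeling \<gamma> M M' f g"
  shows "(\<forall>\<pi>\<in>policies (quotient_mdp M' ES EP). pullback M M' ES EP f g \<pi> \<in> policies M) \<and>
    (\<forall>\<pi>\<in>optimal_policies \<gamma> (quotient_mdp M' ES EP).
       pullback M M' ES EP f g \<pi> \<in> optimal_policies \<gamma> M) \<and>
    (simple_symmetry EP \<longrightarrow>
       (\<forall>\<pi>\<in>policies (quotient_mdp M' ES EP). \<forall>(s, a)\<in>pairs M.
          pullback M M' ES EP f g \<pi> (s, a) = simple_val M' EP \<pi> (g s a) (ES `` {f s})))"
proof -
  have sym: "visible_symmetry M' ES EP"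
    using assms(5) by (simp add: hidden_symmetry_def)
  note bij = equivalence_relabeling_bijections[OF assms(6)]
  have pairs: "(f s, g s a) \<in> pairs M'" if "(s, a) \<in> pairs M" for s a
    using bij[of s] that
    by (auto simp: mem_pairs_iff[OF assms(3)] mem_pairs_iff[OF assms(4)] bij_betw_def)
  \<comment> \<open>The pullback factors through the policy that it induces on the middle process.\<close>
  have pullback: "pullback M M' ES EP f g \<pi> = relabeled_policy M f g (quotient_lift M' ES EP \<pi>)" for \<pi>
    by (auto simp: pullback_def relabeled_policy_def quotient_lift_def restrict_def pairs)
  have "pullback M M' ES EP f g \<pi> \<in> policies M" if "\<pi> \<in> policies (quotient_mdp M' ES EP)" for \<pi>
    unfolding pullback
    by (intro relabeled_policy_in_policies[OF assms(3,4) bij] quotient_lift_in_policies[OF assms(4) sym that])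
  moreover have "pullback M M' ES EP f g \<pi> \<in> optimal_policies \<gamma> M"
    if "\<pi> \<in> optimal_policies \<gamma> (quotient_mdp M' ES EP)" for \<pi>
    unfolding pullback
    by (intro relabeled_policy_optimal_equivalent[OF assms(3,4,1,2,6)]
        quotient_lift_optimal[OF assms(4,1,2) sym that])
  moreover have "pullback M M' ES EP f g \<pi> (s, a) = simple_val M' EP \<pi> (g s a) (ES `` {f s})"
    if "simple_symmetry EP" "(s, a) \<in> pairs M" for \<pi> s a
    using that pairs[OF that(2)]
    by (simp add: pullback_def N_pairs_simple[OF assms(4) sym] simple_val_eq[OF sym])
  ultimately show ?thesis by blast
qed

end
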